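(* Let $R$ be a Dedekind domain with $\operatorname{char}(R)\neq3$ and fraction field $K$, let $\mathfrak a$ be a fractional ideal of $R$, and let $S$ be a nondegenerate quadratic $R$-algebra with $\operatorname{St}(S)=[\mathfrak a]$, equipped with an $\mathfrak a$-orientation. Consider the set of $\approx$-classes of $\mathfrak a$-balanced quadruples $(S,I,\delta,s)$ with first entry $S$ and $I$ an invertible fractional ideal of $S$. The map $(S,I,\delta,s)\mapsto[I]$ is a surjective homomorphism from this set onto $\operatorname{Cl}(S/R)[3]$, and its kernel is isomorphic to $S^\times_{N=1}/S^{\times3}_{N=1}$, where $S^\times_{N=1}$ is the group of units of $S$ of norm $1$ and $S^{\times3}_{N=1}=\{x^3: x\in S^\times_{N=1}\}$.
   Context: $L=S\otimes_RK$, $N=N_{L/K}$. Module index $[M:N]_R$ for rank-$n$ lattices in an $n$-dimensional $K$-space: the fractional ideal of $R$ whose localization at each prime $\mathfrak p$ is $\det(\phi)R_{(\mathfrak p)}$ for any $K$-linear $\phi$ with $\phi(M_{(\mathfrak p)})=N_{(\mathfrak p)}$. $\operatorname{Cl}(S)$ = invertible fractional ideals mod principal ones; $\operatorname{Cl}(S/R)$ = kernel of the norm $\operatorname{Cl}(S)\to\operatorname{Cl}(R)$, $I\mapsto[S:I]_R$. An $\mathfrak a$-orientation is an isomorphism $\bigwedge^2S\to\mathfrak a$. An $\mathfrak a$-balanced quadruple $(S,I,\delta,s)$: $S$ a nondegenerate $\mathfrak a$-oriented quadratic $R$-algebra, $I$ a fractional ideal of $S$, $\delta\in(S\otimes_RK)^\times$,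 $s\in K^\times$, with $I^3\subset\delta S$, $[S:I]_R=sR$, $s^3=N(\delta)$. $(S,I,\delta,s)\approx(S',I',\delta',s')$ if there is a ring isomorphism $\phi:S\to S'$ (not necessarily preserving orientation) and $\kappa\in S'\otimes_RK$ with $I'=\kappa\phi(I)$, $\delta'=\kappa^3\phi(\delta)$, $s'=N(\kappa)s$. Quadruples with fixed $S$ are multiplied componentwise.
   Formalization: The relation ≈ on quadruples with fixed S is taken with φ = id only; if φ may be the conjugation of S, [I] and [I]^{-1} get identified, so the map to Cl(S/R)[3] and the componentwise product are not well defined (e.g. the maximal order of Q(√-23)). *)

theory Defs
  imports "HOL-Algebra.Coset"
begin

section \<open>The base ring R inside its fraction field K (a type of class field)\<close>

definition rsub :: "'k::field set \<Rightarrow> bool" where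
  "rsub R \<longleftrightarrow> 0 \<in> R \<and> 1 \<in> R \<and> (\<forall>a\<in>R. \<forall>b\<in>R. a + b \<in> R \<and> a - b \<in> R \<and> a * b \<in> R)"

definition frac_field_of :: "'k::field set \<Rightarrow> bool" where
  "frac_field_of R \<longleftrightarrow> (\<forall>x::'k. \<exists>a\<in>R. \<exists>b\<in>R. b \<noteq> 0 \<and> x = a / b)"

definition rspan :: "'k::field set \<Rightarrow> 'k set \<Rightarrow> 'k set" where
  "rspan R G = {(\<Sum>g\<in>F. r g * g) | F r. finite F \<and> F \<subseteq> G \<and> (\<forall>g\<in>F. r g \<in> R)}"

definition r_ideal :: "'k::field set \<Rightarrow> 'k set \<Rightarrow> bool" where
  "r_ideal R I \<longleftrightarrow> I \<subseteq> R \<and> 0 \<in> I \<and> (\<forall>a\<in>I. \<forall>b\<in>I. a + b \<in> I) \<and> (\<forall>r\<in>R. \<forall>a\<in>I. r * a \<in> I)"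

definition r_prime_ideal :: "'k::field set \<Rightarrow> 'k set \<Rightarrow> bool" where
  "r_prime_ideal R P \<longleftrightarrow> r_ideal R P \<and> P \<noteq> R \<and> (\<forall>a\<in>R. \<forall>b\<in>R. a * b \<in> P \<longrightarrow> a \<in> P \<or> b \<in> P)"

definition r_maximal_ideal :: "'k::field set \<Rightarrow> 'k set \<Rightarrow> bool" where
  "r_maximal_ideal R P \<longleftrightarrow> r_ideal R P \<and> P \<noteq> R \<and> (\<forall>J. r_ideal R J \<and> P \<subseteq> J \<longrightarrow> J = P \<or> J = R)"

definition r_noetherian :: "'k::field set \<Rightarrow> bool" where
  "r_noetherian R \<longleftrightarrow> (\<forall>I. r_ideal R I \<longrightarrow> (\<exists>F. finite F \<and> F \<subseteq> I \<and> I = rspan R F))"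

definition integral_over :: "'k::field set \<Rightarrow> 'k \<Rightarrow> bool" where
  "integral_over R x \<longleftrightarrow> (\<exists>n c. n > 0 \<and> (\<forall>i<n. c i \<in> R) \<and> x ^ n + (\<Sum>i<n. c i * x ^ i) = 0)"

definition dedekind_domain :: "'k::field set \<Rightarrow> bool" where
  "dedekind_domain R \<longleftrightarrow> rsub R \<and> frac_field_of R \<and> r_noetherian R \<and>
     (\<forall>x. integral_over R x \<longrightarrow> x \<in> R) \<and>
     (\<forall>P. r_prime_ideal R P \<and> P \<noteq> {0} \<longrightarrow> r_maximal_ideal R P)"

definition frac_ideal_R :: "'k::field set \<Rightarrow> 'k set \<Rightarrow> bool" where
  "frac_ideal_R R M \<longleftrightarrow> (\<exists>F. finite F \<and> M = rspan R F) \<and> M \<noteq> {0}"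

definition r_principal :: "'k::field set \<Rightarrow> 'k set \<Rightarrow> bool" where
  "r_principal R J \<longleftrightarrow> (\<exists>s. s \<noteq> 0 \<and> J = (\<lambda>r. s * r) ` R)"

section \<open>The 2-dimensional K-algebra L = S \<otimes>_R K, with structure map emb : K \<rightarrow> L\<close>

definition kalg :: "('k::field \<Rightarrow> 'l::comm_ring_1) \<Rightarrow> bool" where
  "kalg emb \<longleftrightarrow> emb 1 = 1 \<and> (\<forall>a b. emb (a + b) = emb a + emb b \<and> emb (a * b) = emb a * emb b)"

definition is_basis2 :: "('k::field \<Rightarrow> 'l::comm_ring_1) \<Rightarrow> 'l \<Rightarrow> 'l \<Rightarrow> bool" where
  "is_basis2 emb e1 e2 \<longleftrightarrow> (\<forall>x. \<exists>!p. x = emb (fst p) * e1 + emb (snd p) * e2)"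

definition dim2_alg :: "('k::field \<Rightarrow> 'l::comm_ring_1) \<Rightarrow> bool" where
  "dim2_alg emb \<longleftrightarrow> kalg emb \<and> (\<exists>e1 e2. is_basis2 emb e1 e2)"

definition bas :: "('k::field \<Rightarrow> 'l::comm_ring_1) \<Rightarrow> 'l \<times> 'l" where
  "bas emb = (SOME e. is_basis2 emb (fst e) (snd e))"

definition coord :: "('k::field \<Rightarrow> 'l::comm_ring_1) \<Rightarrow> 'l \<Rightarrow> 'k \<times> 'k" where
  "coord emb x = (THE p. x = emb (fst p) * fst (bas emb) + emb (snd p) * snd (bas emb))"

definition klinear :: "('k::field \<Rightarrow> 'l::comm_ring_1) \<Rightarrow> ('l \<Rightarrow> 'l) \<Rightarrow> bool" where
  "klinear emb \<phi> \<longleftrightarrow> (\<forall>a x y. \<phi> (emb a * x + y) = emb a * \<phi> x + \<phi> y)"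

definition detL :: "('k::field \<Rightarrow> 'l::comm_ring_1) \<Rightarrow> ('l \<Rightarrow> 'l) \<Rightarrow> 'k" where
  "detL emb \<phi> = (let e1 = fst (bas emb); e2 = snd (bas emb) in
     fst (coord emb (\<phi> e1)) * snd (coord emb (\<phi> e2)) - snd (coord emb (\<phi> e1)) * fst (coord emb (\<phi> e2)))"

definition normL :: "('k::field \<Rightarrow> 'l::comm_ring_1) \<Rightarrow> 'l \<Rightarrow> 'k" where
  "normL emb x = detL emb (\<lambda>y. x * y)"

definition trL :: "('k::field \<Rightarrow> 'l::comm_ring_1) \<Rightarrow> 'l \<Rightarrow> 'k" where
  "trL emb x = (let e1 = fst (bas emb); e2 = snd (bas emb) in
     fst (coord emb (x * e1)) + snd (coord emb (x * e2)))"

definition nondeg :: "('k::field \<Rightarrow> 'l::comm_ring_1) \<Rightarrow> bool" where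
  "nondeg emb \<longleftrightarrow> (let e1 = fst (bas emb); e2 = snd (bas emb) in
     trL emb (e1 * e1) * trL emb (e2 * e2) - trL emb (e1 * e2) ^ 2 \<noteq> 0)"

definition Lunit :: "'l::comm_ring_1 \<Rightarrow> bool" where
  "Lunit x \<longleftrightarrow> (\<exists>y. x * y = 1)"

definition rspanL :: "'k::field set \<Rightarrow> ('k \<Rightarrow> 'l::comm_ring_1) \<Rightarrow> 'l set \<Rightarrow> 'l set" where
  "rspanL R emb G = {(\<Sum>g\<in>F. emb (r g) * g) | F r. finite F \<and> F \<subseteq> G \<and> (\<forall>g\<in>F. r g \<in> R)}"

definition lattice :: "'k::field set \<Rightarrow> ('k \<Rightarrow> 'l::comm_ring_1) \<Rightarrow> 'l set \<Rightarrow> bool" where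
  "lattice R emb M \<longleftrightarrow> (\<exists>F. finite F \<and> M = rspanL R emb F) \<and>
     (\<forall>x. \<exists>d\<in>R. d \<noteq> 0 \<and> emb d * x \<in> M)"

text \<open>A quadratic R-algebra, realized inside L = S \<otimes>_R K.\<close>
definition quad_alg :: "'k::field set \<Rightarrow> ('k \<Rightarrow> 'l::comm_ring_1) \<Rightarrow> 'l set \<Rightarrow> bool" where
  "quad_alg R emb S \<longleftrightarrow> lattice R emb S \<and> 1 \<in> S \<and> (\<forall>x\<in>S. \<forall>y\<in>S. x * y \<in> S)"

definition iprod :: "'k::field set \<Rightarrow> ('k \<Rightarrow> 'l::comm_ring_1) \<Rightarrow> 'l set \<Rightarrow> 'l set \<Rightarrow> 'l set" where
  "iprod R emb I J = rspanL R emb {x * y | x y. x \<in> I \<and> y \<in> J}"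

definition frac_ideal_S :: "'k::field set \<Rightarrow> ('k \<Rightarrow> 'l::comm_ring_1) \<Rightarrow> 'l set \<Rightarrow> 'l set \<Rightarrow> bool" where
  "frac_ideal_S R emb S I \<longleftrightarrow> lattice R emb I \<and> (\<forall>x\<in>S. \<forall>y\<in>I. x * y \<in> I)"

definition invertible_S :: "'k::field set \<Rightarrow> ('k \<Rightarrow> 'l::comm_ring_1) \<Rightarrow> 'l set \<Rightarrow> 'l set \<Rightarrow> bool" where
  "invertible_S R emb S I \<longleftrightarrow> frac_ideal_S R emb S I \<and>
     (\<exists>J. frac_ideal_S R emb S J \<and> iprod R emb I J = S)"

definition Rloc :: "'k::field set \<Rightarrow> 'k set \<Rightarrow> 'k set" where
  "Rloc R P = {a / b | a b. a \<in> R \<and> b \<in> R \<and> b \<notin> P}"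

definition locK :: "'k::field set \<Rightarrow> 'k set \<Rightarrow> 'k set \<Rightarrow> 'k set" where
  "locK R P J = {j / b | j b. j \<in> J \<and> b \<in> R \<and> b \<notin> P}"

definition locL :: "'k::field set \<Rightarrow> ('k \<Rightarrow> 'l::comm_ring_1) \<Rightarrow> 'k set \<Rightarrow> 'l set \<Rightarrow> 'l set" where
  "locL R emb P M = {emb (inverse b) * m | m b. m \<in> M \<and> b \<in> R \<and> b \<notin> P}"

definition mindex :: "'k::field set \<Rightarrow> ('k \<Rightarrow> 'l::comm_ring_1) \<Rightarrow> 'l set \<Rightarrow> 'l set \<Rightarrow> 'k set" where
  "mindex R emb M N = (THE J. frac_ideal_R R J \<and>
     (\<forall>P. r_prime_ideal R P \<longrightarrow>
        (\<forall>\<phi>. klinear emb \<phi> \<and> \<phi> ` locL R emb P M = locL R emb P N \<longrightarrow>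
              locK R P J = (\<lambda>x. detL emb \<phi> * x) ` Rloc R P)))"

text \<open>wedge^2 L is identified with K via the chosen basis: x \<and> y \<mapsto> det of coordinates.\<close>
definition detpair :: "('k::field \<Rightarrow> 'l::comm_ring_1) \<Rightarrow> 'l \<Rightarrow> 'l \<Rightarrow> 'k" where
  "detpair emb x y = fst (coord emb x) * snd (coord emb y) - snd (coord emb x) * fst (coord emb y)"

definition wedge2 :: "'k::field set \<Rightarrow> ('k \<Rightarrow> 'l::comm_ring_1) \<Rightarrow> 'l set \<Rightarrow> 'k set" where
  "wedge2 R emb S = rspan R {detpair emb x y | x y. x \<in> S \<and> y \<in> S}"

definition steinitz_is :: "'k::field set \<Rightarrow> ('k \<Rightarrow> 'l::comm_ring_1) \<Rightarrow> 'l set \<Rightarrow> 'k set \<Rightarrow> bool" where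
  "steinitz_is R emb S a \<longleftrightarrow> (\<exists>c. c \<noteq> 0 \<and> wedge2 R emb S = (\<lambda>x. c * x) ` a)"

text \<open>An a-orientation: an R-module isomorphism wedge^2 S \<rightarrow> a; such maps between rank-one
  lattices in K are multiplications by a nonzero c.\<close>
definition orientation :: "'k::field set \<Rightarrow> ('k \<Rightarrow> 'l::comm_ring_1) \<Rightarrow> 'l set \<Rightarrow> 'k set \<Rightarrow> 'k \<Rightarrow> bool" where
  "orientation R emb S a c \<longleftrightarrow> c \<noteq> 0 \<and> (\<lambda>w. c * w) ` wedge2 R emb S = a"

definition clS :: "'k::field set \<Rightarrow> ('k \<Rightarrow> 'l::comm_ring_1) \<Rightarrow> 'l set \<Rightarrow> 'l set \<Rightarrow> 'l set set" where
  "clS R emb S I = {J. invertible_S R emb S J \<and> (\<exists>\<kappa>. Lunit \<kappa> \<and> J = (\<lambda>x. \<kappa> * x) ` I)}"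

text \<open>Cl(S/R): kernel of the norm Cl(S) \<rightarrow> Cl(R), [I] \<mapsto> [[S:I]_R].\<close>
definition ClSR :: "'k::field set \<Rightarrow> ('k \<Rightarrow> 'l::comm_ring_1) \<Rightarrow> 'l set \<Rightarrow> 'l set set monoid" where
  "ClSR R emb S = \<lparr>carrier = {clS R emb S I | I. invertible_S R emb S I \<and> r_principal R (mindex R emb S I)},
     monoid.mult = (\<lambda>A B. clS R emb S (iprod R emb (SOME I. I \<in> A) (SOME J. J \<in> B))),
     one = clS R emb S S\<rparr>"

definition ClSR3 :: "'k::field set \<Rightarrow> ('k \<Rightarrow> 'l::comm_ring_1) \<Rightarrow> 'l set \<Rightarrow> 'l set set monoid" where
  "ClSR3 R emb S = (ClSR R emb S)\<lparr>carrier :=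
     {x \<in> carrier (ClSR R emb S). x [^]\<^bsub>ClSR R emb S\<^esub> (3::nat) = \<one>\<^bsub>ClSR R emb S\<^esub>}\<rparr>"

text \<open>A quadruple (S, I, \<delta>, s) with S fixed is represented by the triple (I, \<delta>, s).\<close>
definition balanced :: "'k::field set \<Rightarrow> ('k \<Rightarrow> 'l::comm_ring_1) \<Rightarrow> 'l set \<Rightarrow> 'l set \<times> 'l \<times> 'k \<Rightarrow> bool" where
  "balanced R emb S q \<longleftrightarrow> (case q of (I, \<delta>, s) \<Rightarrow>
     frac_ideal_S R emb S I \<and> Lunit \<delta> \<and> s \<noteq> 0 \<and>
     iprod R emb I (iprod R emb I I) \<subseteq> (\<lambda>x. \<delta> * x) ` S \<and>
     mindex R emb S I = (\<lambda>r. s * r) ` R \<and> s ^ 3 = normL emb \<delta>)"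

definition QB :: "'k::field set \<Rightarrow> ('k \<Rightarrow> 'l::comm_ring_1) \<Rightarrow> 'l set \<Rightarrow> ('l set \<times> 'l \<times> 'k) set" where
  "QB R emb S = {q. balanced R emb S q \<and> invertible_S R emb S (fst q)}"

definition qequiv :: "('k::field \<Rightarrow> 'l::comm_ring_1) \<Rightarrow> 'l set \<times> 'l \<times> 'k \<Rightarrow> 'l set \<times> 'l \<times> 'k \<Rightarrow> bool" where
  "qequiv emb q q' \<longleftrightarrow> (case q of (I, \<delta>, s) \<Rightarrow> case q' of (I', \<delta>', s') \<Rightarrow>
     (\<exists>\<kappa>. Lunit \<kappa> \<and> I' = (\<lambda>x. \<kappa> * x) ` I \<and> \<delta>' = \<kappa> ^ 3 * \<delta> \<and> s' = normL emb \<kappa> * s))"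

definition qcl :: "'k::field set \<Rightarrow> ('k \<Rightarrow> 'l::comm_ring_1) \<Rightarrow> 'l set \<Rightarrow> 'l set \<times> 'l \<times> 'k \<Rightarrow> ('l set \<times> 'l \<times> 'k) set" where
  "qcl R emb S q = {q' \<in> QB R emb S. qequiv emb q q'}"

definition qmult :: "'k::field set \<Rightarrow> ('k \<Rightarrow> 'l::comm_ring_1) \<Rightarrow> 'l set \<times> 'l \<times> 'k \<Rightarrow> 'l set \<times> 'l \<times> 'k \<Rightarrow> 'l set \<times> 'l \<times> 'k" where
  "qmult R emb q q' = (case q of (I, \<delta>, s) \<Rightarrow> case q' of (I', \<delta>', s') \<Rightarrow> (iprod R emb I I', \<delta> * \<delta>', s * s'))"

definition QG :: "'k::field set \<Rightarrow> ('k \<Rightarrow> 'l::comm_ring_1) \<Rightarrow> 'l set \<Rightarrow> ('l set \<times> 'l \<times> 'k) set monoid" where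
  "QG R emb S = \<lparr>carrier = qcl R emb S ` QB R emb S,
     monoid.mult = (\<lambda>A B. qcl R emb S (qmult R emb (SOME a. a \<in> A) (SOME b. b \<in> B))),
     one = qcl R emb S (S, 1, 1)\<rparr>"

definition UN1 :: "('k::field \<Rightarrow> 'l::comm_ring_1) \<Rightarrow> 'l set \<Rightarrow> 'l monoid" where
  "UN1 emb S = \<lparr>carrier = {x \<in> S. (\<exists>y\<in>S. x * y = 1) \<and> normL emb x = 1},
     monoid.mult = (*), one = 1\<rparr>"

definition UN1_cubes :: "('k::field \<Rightarrow> 'l::comm_ring_1) \<Rightarrow> 'l set \<Rightarrow> 'l set" where
  "UN1_cubes emb S = {x ^ 3 | x. x \<in> carrier (UN1 emb S)}"

end

theory Submission
  imports Defs
begin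

text \<open>
  For a fractional ideal \<open>I\<close> of \<open>S\<close> let \<open>n(I)\<close> be the \<open>R\<close>-module generated by the norms of its
  elements. If \<open>I J = S\<close>, then at every prime \<open>P\<close> some \<open>x \<in> I\<close> and \<open>y \<in> J\<close> have \<open>N(x y)\<close> outside \<open>P\<close>,
  so \<open>x\<close> generates \<open>I\<close> at \<open>P\<close>, and the module index of an invertible \<open>I\<close> is \<open>n(I)\<close>. Both this and
  the multiplicativity of \<open>n\<close> rest on one computation with the polar form \<open>B\<close> of the norm:
  \<open>B(x y, x' y')\<close> and \<open>B(x y', x' y)\<close> have sum and product expressible through values of \<open>N\<close> and \<open>B\<close>
  on the separate factors, hence are integral over what these generate.

  An ideal \<open>J \<subseteq> S\<close> with \<open>1 \<in> n(J)\<close> is all of \<open>S\<close>, because \<open>N(x) = x * cj x \<in> J\<close> for \<open>x \<in> J\<close>. So an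
  invertible balanced \<open>(I, \<delta>, s)\<close> satisfies \<open>I\<^sup>3 = \<delta> S\<close>, which gives the inverse
  \<open>(\<delta>\<^sup>-\<^sup>1 I\<^sup>2, \<delta>\<^sup>-\<^sup>1, s\<^sup>-\<^sup>1)\<close> and shows that the class of \<open>I\<close> is 3-torsion. Conversely, if \<open>I\<^sup>3 = \<delta> S\<close>
  and \<open>n(I) = s R\<close>, then \<open>s\<^sup>3 / N(\<delta>)\<close> is a unit of \<open>R\<close>, and \<open>\<delta>\<close> and \<open>s\<close> can be corrected by units.
  Every class in the kernel contains a triple \<open>(S, \<epsilon>, 1)\<close> with \<open>\<epsilon>\<close> a unit of norm 1, and \<open>\<epsilon>\<close> is
  determined up to cubes of such units.
\<close>

section \<open>Quadratic algebras over a field\<close>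

locale quadratic_algebra =
  fixes emb :: "'k::field \<Rightarrow> 'l::comm_ring_1"
  assumes dim2: "dim2_alg emb"
begin

abbreviation "N \<equiv> normL emb"

lemma emb_1 [simp]: "emb 1 = 1"
  and emb_add: "emb (a + b) = emb a + emb b"
  and emb_mult: "emb (a * b) = emb a * emb b"
  using dim2 by (auto simp: dim2_alg_def kalg_def)

lemma emb_0 [simp]: "emb 0 = 0"
  using emb_add[of 0 0] by simp

lemma emb_minus: "emb (- a) = - emb a"
  using emb_add[of a "- a"] by (simp add: eq_neg_iff_add_eq_0 add.commute)

lemma emb_diff: "emb (a - b) = emb a - emb b"
  using emb_add[of a "- b"] by (simp add: emb_minus)

lemma emb_2 [simp]: "emb 2 = 2"
  using emb_add[of 1 1] by simp

lemmas emb_simps = emb_add emb_mult emb_diff emb_minus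

lemma emb_inverse: "a \<noteq> 0 \<Longrightarrow> emb a * emb (inverse a) = 1"
  by (metis emb_1 emb_mult right_inverse)

section \<open>Coordinates, determinants and linear maps in the chosen basis\<close>

abbreviation "e1 \<equiv> fst (bas emb)"
abbreviation "e2 \<equiv> snd (bas emb)"

lemma is_basis: "is_basis2 emb e1 e2"
proof -
  obtain u v where "is_basis2 emb u v" using dim2 by (auto simp: dim2_alg_def)
  then have "is_basis2 emb (fst (u, v)) (snd (u, v))" by simp
  then show ?thesis unfolding bas_def by (rule someI)
qed

lemma coord_eqI: "x = emb a * e1 + emb b * e2 \<Longrightarrow> coord emb x = (a, b)"
proof -
  assume x: "x = emb a * e1 + emb b * e2"
  have "\<exists>!p. x = emb (fst p) * e1 + emb (snd p) * e2"
    using is_basis unfolding is_basis2_def by blast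
  then show ?thesis unfolding coord_def
    by (rule the1_equality) (simp add: x)
qed

lemma coord_expand: "x = emb (fst (coord emb x)) * e1 + emb (snd (coord emb x)) * e2"
proof -
  obtain p where "x = emb (fst p) * e1 + emb (snd p) * e2"
    using is_basis unfolding is_basis2_def by blast
  with coord_eqI[OF this] show ?thesis by simp
qed

lemma coord_lin: "coord emb (emb a * x + y) =
   (a * fst (coord emb x) + fst (coord emb y), a * snd (coord emb x) + snd (coord emb y))"
proof (rule coord_eqI)
  have "emb a * x + y = emb a * (emb (fst (coord emb x)) * e1 + emb (snd (coord emb x)) * e2)
      + (emb (fst (coord emb y)) * e1 + emb (snd (coord emb y)) * e2)"
    using coord_expand[of x] coord_expand[of y] by simp
  then show "emb a * x + y = emb (a * fst (coord emb x) + fst (coord emb y)) * e1 +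
      emb (a * snd (coord emb x) + snd (coord emb y)) * e2"
    by (simp add: emb_simps algebra_simps)
qed

lemma coord_e1 [simp]: "coord emb e1 = (1, 0)" and coord_e2 [simp]: "coord emb e2 = (0, 1)"
  by (rule coord_eqI, simp)+

lemma coord_0 [simp]: "coord emb 0 = (0, 0)"
  by (rule coord_eqI) simp

lemma emb_eq_0_iff [simp]: "emb a = 0 \<longleftrightarrow> a = 0"
proof
  assume "emb a = 0"
  then have "0 = emb a * e1" by simp
  with coord_eqI[of 0 a 0] show "a = 0" by simp
qed simp

lemma emb_eq_iff [simp]: "emb a = emb b \<longleftrightarrow> a = b"
  using emb_eq_0_iff[of "a - b"] by (simp add: emb_diff)

lemma detpair_lin_left: "detpair emb (emb a * x + y) z = a * detpair emb x z + detpair emb y z"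
  and detpair_lin_right: "detpair emb z (emb a * x + y) = a * detpair emb z x + detpair emb z y"
  unfolding detpair_def coord_lin by (simp_all add: algebra_simps)

lemma detpair_self [simp]: "detpair emb x x = 0"
  by (simp add: detpair_def)

lemma detpair_swap: "detpair emb y x = - detpair emb x y"
  by (simp add: detpair_def)

lemma klinear_scale:
  assumes "klinear emb \<phi>" shows "\<phi> (emb a * x) = emb a * \<phi> x"
proof -
  have "\<phi> (emb 1 * 0 + 0) = emb 1 * \<phi> 0 + \<phi> 0" using assms by (simp only: klinear_def)
  then have "\<phi> 0 = 0" by simp
  moreover have "\<phi> (emb a * x + 0) = emb a * \<phi> x + \<phi> 0" using assms by (simp only: klinear_def)
  ultimately show ?thesis by simp
qed

lemma klinear_add:
  assumes "klinear emb \<phi>" shows "\<phi> (x + y) = \<phi> x + \<phi> y"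
proof -
  have "\<phi> (emb 1 * x + y) = emb 1 * \<phi> x + \<phi> y" using assms by (simp only: klinear_def)
  then show ?thesis by simp
qed

lemma klinear_mult: "klinear emb (\<lambda>y. x * y)"
  by (simp add: klinear_def algebra_simps)

lemma klinear_comp: "klinear emb \<phi> \<Longrightarrow> klinear emb \<psi> \<Longrightarrow> klinear emb (\<lambda>x. \<phi> (\<psi> x))"
  by (simp add: klinear_def)

text \<open>After expansion in the basis only the term pairing \<open>\<phi> e1\<close> with
  \<open>\<phi> e2\<close> survives, because the pairing is alternating. This allows
  \<open>detL\<close> to be computed on any independent pair instead of the chosen basis.\<close>

lemma detpair_klinear:
  assumes "klinear emb \<phi>"
  shows "detpair emb (\<phi> x) (\<phi> y) = detL emb \<phi> * detpair emb x y"
proof -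
  have *: "\<phi> z = emb (fst (coord emb z)) * \<phi> e1 + (emb (snd (coord emb z)) * \<phi> e2 + 0)" for z
    using coord_expand[of z] klinear_add[OF assms] klinear_scale[OF assms] by (metis add.right_neutral)
  show ?thesis
    unfolding detL_def Let_def detpair_def
    by (subst *[of x], subst *[of x], subst *[of y], subst *[of y], unfold coord_lin)
      (simp add: algebra_simps)
qed

lemma detL_comp:
  assumes "klinear emb \<phi>" "klinear emb \<psi>"
  shows "detL emb (\<lambda>x. \<phi> (\<psi> x)) = detL emb \<phi> * detL emb \<psi>"
proof -
  have 1: "detpair emb e1 e2 = 1" by (simp add: detpair_def)
  have "detL emb (\<lambda>x. \<phi> (\<psi> x)) * detpair emb e1 e2 = detpair emb (\<phi> (\<psi> e1)) (\<phi> (\<psi> e2))"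
    by (rule detpair_klinear[symmetric, OF klinear_comp[OF assms]])
  also have "\<dots> = detL emb \<phi> * (detL emb \<psi> * detpair emb e1 e2)"
    by (simp add: detpair_klinear[OF assms(1)] detpair_klinear[OF assms(2)])
  finally show ?thesis by (simp add: 1)
qed

lemma detL_id: "detL emb (\<lambda>x. x) = 1"
  by (simp add: detL_def)

text \<open>Since 1 is nonzero, it forms a basis together with some \<open>\<omega>\<close>;
  expressing \<open>\<omega> * \<omega>\<close> in this basis gives the relation, in which
  \<open>t\<close> and \<open>n\<close> are the trace and norm of \<open>\<omega>\<close>. The
  conjugation is studied below in these coordinates.\<close>

lemma obtain_generator:
  obtains \<omega> t n where "\<omega> * \<omega> = emb t * \<omega> - emb n" "\<forall>x. \<exists>a b. x = emb a + emb b * \<omega>"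
    "\<forall>a b. N (emb a + emb b * \<omega>) = a * a + a * b * t + n * b * b"
proof -
  obtain p q where pq: "coord emb 1 = (p, q)" by fastforce
  have one: "1 = emb p * e1 + emb q * e2" using coord_expand[of 1] by (simp add: pq)
  have "p \<noteq> 0 \<or> q \<noteq> 0"
    using one emb_eq_0_iff[of 1] by (metis add_0 emb_0 emb_1 mult_zero_left one_neq_zero)
  \<comment> \<open>The pairing of 1 with \<open>e2\<close> is \<open>p\<close>, and with
    \<open>e1\<close> it is \<open>- q\<close>, so one of the two basis vectors will do.\<close>
  then obtain \<omega> where D: "detpair emb 1 \<omega> \<noteq> 0"
    by (elim disjE) (auto simp: detpair_def pq intro: that[of e2] that[of e1])
  have span: "\<exists>a b. x = emb a + emb b * \<omega>" for x
  proof -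
    \<comment> \<open>Cramer's rule for the independent pair 1, \<open>\<omega>\<close>.\<close>
    let ?D = "detpair emb 1 \<omega>" and ?a = "detpair emb x \<omega>" and ?b = "detpair emb 1 x"
    have "emb ?D * x = emb ?a + emb ?b * \<omega>"
    proof -
      obtain u v where uv: "coord emb \<omega> = (u, v)" by fastforce
      obtain y z where yz: "coord emb x = (y, z)" by fastforce
      have x: "x = emb y * e1 + emb z * e2" and w: "\<omega> = emb u * e1 + emb v * e2"
        using coord_expand[of x] coord_expand[of \<omega>] by (simp_all add: uv yz)
      have "emb ?D * (emb y * e1 + emb z * e2)
          = emb ?a * (emb p * e1 + emb q * e2) + emb ?b * (emb u * e1 + emb v * e2)"
        by (simp add: detpair_def pq uv yz emb_simps algebra_simps)
      then show ?thesis by (simp flip: x w one)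
    qed
    then have "emb (inverse ?D) * (emb ?D * x) = emb (inverse ?D) * (emb ?a + emb ?b * \<omega>)"
      by simp
    moreover have "emb (inverse ?D) * (emb ?D * x) = x"
      using D by (simp flip: mult.assoc emb_mult)
    ultimately have "x = emb (inverse ?D * ?a) + emb (inverse ?D * ?b) * \<omega>"
      by (simp add: emb_mult distrib_left mult.assoc)
    then show ?thesis by blast
  qed
  obtain n' t where tn': "\<omega> * \<omega> = emb n' + emb t * \<omega>" using span by blast
  define n where "n = - n'"
  have tn: "\<omega> * \<omega> = emb t * \<omega> - emb n" by (simp add: tn' n_def emb_minus)
  have "N (emb a + emb b * \<omega>) = a * a + a * b * t + n * b * b" for a b
  proof -
    let ?x = "emb a + emb b * \<omega>"
    have x1: "?x = emb a * 1 + (emb b * \<omega> + 0)" by simp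
    have "?x * \<omega> = emb a * \<omega> + emb b * (\<omega> * \<omega>)" by (simp add: algebra_simps)
    then have x2: "?x * \<omega> = emb (- (n * b)) * 1 + (emb (a + b * t) * \<omega> + 0)"
      unfolding tn by (simp add: emb_simps algebra_simps)
    have d0: "detpair emb z 0 = 0" "detpair emb 0 z = 0" for z by (simp_all add: detpair_def)
    \<comment> \<open>The determinant of multiplication by \<open>?x\<close> is evaluated on the
      pair 1, \<open>\<omega>\<close>, where both images are known.\<close>
    have "N ?x * detpair emb 1 \<omega> = detpair emb (?x * 1) (?x * \<omega>)"
      unfolding normL_def by (rule detpair_klinear[OF klinear_mult, symmetric])
    also have "\<dots> = detpair emb (emb a * 1 + (emb b * \<omega> + 0)) (emb (- (n * b)) * 1 + (emb (a + b * t) * \<omega> + 0))"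
      by (simp only: x2 mult_1_right add_0_right)
    also have "\<dots> = (a * a + a * b * t + n * b * b) * detpair emb 1 \<omega>"
      by (simp only: detpair_lin_left detpair_lin_right d0 detpair_self detpair_swap[of \<omega> 1])
        (simp add: algebra_simps)
    finally show ?thesis using D by simp
  qed
  then show thesis using that tn span by blast
qed

section \<open>Conjugation and the polar form of the norm\<close>

definition trace where "trace x = N (x + 1) - N x - 1"

text \<open>Polarising the norm against 1 gives the trace without reference to a basis; subtracting
  \<open>x\<close> from the trace gives the standard involution of the quadratic algebra.\<close>

definition cj where "cj x = emb (trace x) - x"

definition B where "B x y = N (x + y) - N x - N y"

text \<open>In the coordinates of \<open>obtain_generator\<close> the involution sends
  \<open>\<omega>\<close> to \<open>emb t - \<omega>\<close>, the conjugate root of its equation.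
  Each claim is then a polynomial identity modulo the relation for
  \<open>\<omega> * \<omega>\<close>.\<close>

lemma cj_add: "cj (x + y) = cj x + cj y"
  and cj_mult: "cj (x * y) = cj x * cj y"
  and mult_cj: "x * cj x = emb (N x)"
  and cj_emb: "cj (emb r) = emb r"
proof -
  obtain \<omega> t n where w: "\<omega> * \<omega> = emb t * \<omega> - emb n" "\<forall>x. \<exists>a b. x = emb a + emb b * \<omega>"
    and N': "\<forall>a b. N (emb a + emb b * \<omega>) = a * a + a * b * t + n * b * b"
    by (rule obtain_generator)
  note N = N'[rule_format]
  obtain a b where x: "x = emb a + emb b * \<omega>" using w(2) by blast
  obtain c d where y: "y = emb c + emb d * \<omega>" using w(2) by blast
  have cj: "cj (emb a + emb b * \<omega>) = emb (a + b * t) - emb b * \<omega>" for a b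
  proof -
    have "emb a + emb b * \<omega> + 1 = emb (a + 1) + emb b * \<omega>" by (simp add: emb_simps)
    then show ?thesis
      unfolding cj_def trace_def by (simp only: N) (simp add: emb_simps algebra_simps)
  qed
  have s: "x + y = emb (a + c) + emb (b + d) * \<omega>" by (simp add: x y emb_simps algebra_simps)
  have "x * y = emb (a * c) + emb (a * d + b * c) * \<omega> + emb (b * d) * (\<omega> * \<omega>)"
    by (simp add: x y emb_simps algebra_simps)
  then have p: "x * y = emb (a * c - b * d * n) + emb (a * d + b * c + b * d * t) * \<omega>"
    unfolding w(1) by (simp add: emb_simps algebra_simps)
  show "cj (x + y) = cj x + cj y"
    unfolding s cj unfolding x y cj by (simp add: emb_simps algebra_simps)
  have "cj x * cj y = emb ((a + b * t) * (c + d * t)) - emb ((a + b * t) * d + b * (c + d * t)) * \<omega>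
     + emb (b * d) * (\<omega> * \<omega>)"
    unfolding x y cj by (simp add: emb_simps algebra_simps)
  then show "cj (x * y) = cj x * cj y"
    unfolding w(1) p cj by (simp add: emb_simps algebra_simps)
  have "x * cj x = emb (a * (a + b * t)) + emb (b * b * t) * \<omega> - emb (b * b) * (\<omega> * \<omega>)"
    unfolding x cj by (simp add: emb_simps algebra_simps)
  then show "x * cj x = emb (N x)"
    unfolding w(1) unfolding x N by (simp add: emb_simps algebra_simps)
  show "cj (emb r) = emb r" using cj[of r 0] by simp
qed

lemma add_cj: "x + cj x = emb (trace x)"
  by (simp add: cj_def)

lemma cj_cj: "cj (cj x) = x"
proof -
  have "cj (x + cj x) = x + cj x" by (simp only: add_cj cj_emb)
  then have "cj x + cj (cj x) = x + cj x" by (simp only: cj_add)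
  then show ?thesis by (metis add.commute add_left_imp_eq)
qed

lemma N_cj: "N (cj x) = N x"
proof -
  have "emb (N (cj x)) = cj x * x" by (simp only: mult_cj[symmetric] cj_cj)
  then show ?thesis by (metis emb_eq_iff mult.commute mult_cj)
qed

lemma N_mult: "N (x * y) = N x * N y"
proof -
  have "emb (N (x * y)) = (x * cj x) * (y * cj y)"
    by (simp only: mult_cj[symmetric] cj_mult mult.assoc mult.left_commute)
  then show ?thesis by (simp only: mult_cj emb_mult[symmetric] emb_eq_iff)
qed

lemma N_emb: "N (emb r) = r * r"
  by (metis cj_emb emb_eq_iff emb_mult mult_cj)

lemma N_1 [simp]: "N 1 = 1"
  using N_emb[of 1] by simp

lemma N_0 [simp]: "N 0 = 0"
  using N_emb[of 0] by simp

lemma N_power: "N (x ^ n) = N x ^ n"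
  by (induction n) (auto simp: N_mult)

lemma N_add: "N (x + y) = N x + N y + B x y"
  by (simp add: B_def)

text \<open>This turns identities between values of \<open>N\<close> and \<open>B\<close> into
  identities between elements and their conjugates. They can be checked in the commutative ring
  containing \<open>S\<close>, since \<open>emb\<close> is injective.\<close>

lemma emb_B: "emb (B x y) = x * cj y + cj x * y"
  by (simp add: B_def emb_simps algebra_simps cj_add flip: mult_cj)

lemma B_add: "B x (y + z) = B x y + B x z"
proof -
  have "emb (B x (y + z)) = emb (B x y + B x z)"
    by (simp add: emb_simps emb_B cj_add algebra_simps)
  then show ?thesis by simp
qed

lemma B_scale: "B x (emb r * y) = r * B x y"
proof -
  have "emb (B x (emb r * y)) = emb (r * B x y)"
    by (simp add: emb_simps emb_B cj_mult cj_emb algebra_simps)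
  then show ?thesis by simp
qed

lemma B_commute: "B x y = B y x"
  by (simp add: B_def add.commute)

lemma B_add_left: "B (x + y) z = B x z + B y z"
  by (simp only: B_commute[of _ z] B_add)

lemma B_scale_left: "B (emb r * x) z = r * B x z"
  by (simp only: B_commute[of _ z] B_scale)

lemma B_0_right [simp]: "B x 0 = 0"
  by (simp add: B_def)

text \<open>The two values of B occurring here are the roots of a monic quadratic polynomial whose
  coefficients only involve values of N and B on the separate factors.\<close>

lemma B_products_sum: "B (x * y) (x' * y') + B (x * y') (x' * y) = B x x' * B y y'"
proof -
  have "emb (B (x * y) (x' * y') + B (x * y') (x' * y)) = emb (B x x' * B y y')"
    by (simp add: emb_simps emb_B cj_mult algebra_simps)
  then show ?thesis by simp
qed

lemma B_products_mult:
  "B (x * y) (x' * y') * B (x * y') (x' * y) =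
    N y * N y' * (B x x' * B x x') + N x * N x' * (B y y' * B y y') - 4 * (N x * N y * (N x' * N y'))"
proof -
  \<comment> \<open>\<open>emb\<close> is known to respect sums but not numerals, so the factor 4 is
    split additively.\<close>
  have four: "emb (4 * r) = 4 * emb r" for r
  proof -
    have "4 * r = (r + r) + (r + r)" by simp
    also have "emb \<dots> = (emb r + emb r) + (emb r + emb r)" by (simp only: emb_add)
    finally show ?thesis by simp
  qed
  have "emb (B (x * y) (x' * y') * B (x * y') (x' * y)) =
    emb (N y * N y' * (B x x' * B x x') + N x * N x' * (B y y' * B y y') - 4 * (N x * N y * (N x' * N y')))"
    unfolding emb_diff four unfolding emb_simps emb_B cj_mult mult_cj[symmetric]
    by (simp add: algebra_simps)
  then show ?thesis by simp
qed

text \<open>The inverse is the conjugate divided by the norm. The algebra may have zero divisors, so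
  units are recognised by their norm and not by being nonzero.\<close>

lemma Lunit_iff: "Lunit x \<longleftrightarrow> N x \<noteq> 0"
proof
  assume "Lunit x"
  then obtain y where "x * y = 1" by (auto simp: Lunit_def)
  then have "N x * N y = 1" by (metis N_1 N_mult)
  then show "N x \<noteq> 0" by auto
next
  assume "N x \<noteq> 0"
  then have "x * (cj x * emb (inverse (N x))) = 1"
    by (simp add: mult_cj emb_inverse flip: mult.assoc)
  then show "Lunit x" unfolding Lunit_def by blast
qed

lemma N_eq_inverse: "x * y = 1 \<Longrightarrow> N y = inverse (N x)"
  by (metis N_1 N_mult inverse_unique)

end

section \<open>Modules over a subring of a field\<close>

text \<open>The structure map is a parameter so that the same notion covers submodules of the
  quadratic algebra and, with the identity map, submodules of \<open>K\<close> such as ideals of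
  \<open>R\<close>.\<close>

definition rmod :: "'k::field set \<Rightarrow> ('k \<Rightarrow> 'l::comm_ring_1) \<Rightarrow> 'l set \<Rightarrow> bool" where
  "rmod R emb M \<longleftrightarrow> 0 \<in> M \<and> (\<forall>x\<in>M. \<forall>y\<in>M. x + y \<in> M) \<and> (\<forall>r\<in>R. \<forall>x\<in>M. emb r * x \<in> M)"

lemma rmodI:
  assumes "0 \<in> M" "\<And>x y. x \<in> M \<Longrightarrow> y \<in> M \<Longrightarrow> x + y \<in> M"
    "\<And>r x. r \<in> R \<Longrightarrow> x \<in> M \<Longrightarrow> emb r * x \<in> M"
  shows "rmod R emb M"
  using assms by (auto simp: rmod_def)

lemma rmodD:
  assumes "rmod R emb M"
  shows "0 \<in> M" "x \<in> M \<Longrightarrow> y \<in> M \<Longrightarrow> x + y \<in> M" "r \<in> R \<Longrightarrow> x \<in> M \<Longrightarrow> emb r * x \<in> M"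
  using assms by (auto simp: rmod_def)

lemma rspanL_least:
  assumes "rmod R emb M" "G \<subseteq> M"
  shows "rspanL R emb G \<subseteq> M"
proof
  fix x assume "x \<in> rspanL R emb G"
  then obtain F r where F: "finite F" "F \<subseteq> G" "\<forall>g\<in>F. r g \<in> R" and x: "x = (\<Sum>g\<in>F. emb (r g) * g)"
    by (auto simp: rspanL_def)
  have "(\<Sum>g\<in>F. emb (r g) * g) \<in> M"
    using F assms(2) by (induction F) (auto intro!: rmodD[OF assms(1)])
  then show "x \<in> M" by (simp add: x)
qed

lemma rspan_eq_rspanL: "rspan R G = rspanL R (\<lambda>x. x) G"
  by (simp add: rspan_def rspanL_def)

lemma kalg_id: "kalg (\<lambda>x. x)"
  by (simp add: kalg_def)

lemma rspanL_superset:
  assumes "rsub R" "kalg emb"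
  shows "G \<subseteq> rspanL R emb G"
proof
  fix g assume "g \<in> G"
  then have "finite {g}" "{g} \<subseteq> G" "\<forall>g\<in>{g}. (1::'a) \<in> R" "g = (\<Sum>g\<in>{g}. emb 1 * g)"
    using assms by (auto simp: rsub_def kalg_def)
  then show "g \<in> rspanL R emb G" unfolding rspanL_def by fastforce
qed

lemma rmod_rspanL:
  assumes "rsub R" "kalg emb"
  shows "rmod R emb (rspanL R emb G)"
proof (rule rmodI)
  have "emb 0 + emb 0 = emb 0" using assms(2) unfolding kalg_def by (metis add_0)
  then have emb0: "emb 0 = 0" by simp
  show "0 \<in> rspanL R emb G" unfolding rspanL_def
    by (rule CollectI, rule exI[of _ "{}"]) simp
  fix x assume "x \<in> rspanL R emb G"
  then obtain F r where F: "finite F" "F \<subseteq> G" "\<forall>g\<in>F. r g \<in> R" "x = (\<Sum>g\<in>F. emb (r g) * g)"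
    by (auto simp: rspanL_def)
  {
    fix y assume "y \<in> rspanL R emb G"
    then obtain H q where H: "finite H" "H \<subseteq> G" "\<forall>g\<in>H. q g \<in> R" "y = (\<Sum>g\<in>H. emb (q g) * g)"
      by (auto simp: rspanL_def)
    \<comment> \<open>Both combinations are rewritten over the union of their supports, with
      coefficient 0 outside the original support.\<close>
    let ?p = "\<lambda>g. (if g \<in> F then r g else 0) + (if g \<in> H then q g else 0)"
    have x: "x = (\<Sum>g\<in>F \<union> H. emb (if g \<in> F then r g else 0) * g)"
      unfolding F(4) using F(1) H(1) emb0 by (intro sum.mono_neutral_cong_left) auto
    have y: "y = (\<Sum>g\<in>F \<union> H. emb (if g \<in> H then q g else 0) * g)"
      unfolding H(4) using F(1) H(1) emb0 by (intro sum.mono_neutral_cong_left) auto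
    have "x + y = (\<Sum>g\<in>F \<union> H. emb (?p g) * g)"
      unfolding x y using assms(2) by (simp add: kalg_def sum.distrib[symmetric] distrib_right)
    moreover have "\<forall>g\<in>F \<union> H. ?p g \<in> R" using assms(1) F(3) H(3) by (auto simp: rsub_def)
    ultimately show "x + y \<in> rspanL R emb G"
      using F(1,2) H(1,2) unfolding rspanL_def
      by (intro CollectI exI[of _ "F \<union> H"] exI[of _ ?p]) auto
  }
  fix c assume "c \<in> R"
  have "emb c * x = (\<Sum>g\<in>F. emb (c * r g) * g)"
    using assms(2) by (simp add: F(4) sum_distrib_left kalg_def mult.assoc)
  moreover have "\<forall>g\<in>F. c * r g \<in> R" using assms(1) F(3) \<open>c \<in> R\<close> by (auto simp: rsub_def)
  ultimately show "emb c * x \<in> rspanL R emb G"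
    using F(1,2) unfolding rspanL_def
    by (intro CollectI exI[of _ F] exI[of _ "\<lambda>g. c * r g"]) auto
qed

lemma rsub_uminus: "rsub R \<Longrightarrow> a \<in> R \<Longrightarrow> - a \<in> R"
  unfolding rsub_def by (metis diff_0)

section \<open>Prime ideals and the local-global principle\<close>

lemma r_ideal_iff: "r_ideal R Q \<longleftrightarrow> Q \<subseteq> R \<and> rmod R (\<lambda>x. x) Q"
  by (auto simp: r_ideal_def rmod_def)

text \<open>Zorn's lemma yields an ideal that is maximal among those containing \<open>Q\<close> and
  missing 1, and such an ideal is prime.\<close>

lemma prime_ideal_over:
  assumes R: "rsub R" and Q: "r_ideal R Q" and "1 \<notin> Q"
  obtains P where "r_prime_ideal R P" "Q \<subseteq> P"
proof -
  let ?A = "{J. r_ideal R J \<and> Q \<subseteq> J \<and> 1 \<notin> J}"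
  have "\<exists>P\<in>?A. \<forall>X\<in>?A. P \<subseteq> X \<longrightarrow> X = P"
  proof (rule subset_Zorn_nonempty)
    show "?A \<noteq> {}" using assms by blast
    fix C assume C: "C \<noteq> {}" "subset.chain ?A C"
    then have CA: "C \<subseteq> ?A" and ch: "\<And>X Y. X \<in> C \<Longrightarrow> Y \<in> C \<Longrightarrow> X \<subseteq> Y \<or> Y \<subseteq> X"
      by (auto simp: subset.chain_def)
    have "a + b \<in> \<Union>C" if ab: "a \<in> \<Union>C" "b \<in> \<Union>C" for a b
    proof -
      obtain X Y where XY: "X \<in> C" "Y \<in> C" "a \<in> X" "b \<in> Y" using ab by blast
      with ch[of X Y] obtain Z where "Z \<in> C" "a \<in> Z" "b \<in> Z" by blast
      moreover have "r_ideal R Z" using CA \<open>Z \<in> C\<close> by blast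
      ultimately show ?thesis by (auto simp: r_ideal_def)
    qed
    moreover have "r * a \<in> \<Union>C" if ra: "r \<in> R" "a \<in> \<Union>C" for r a
    proof -
      obtain X where "X \<in> C" "a \<in> X" using ra by blast
      moreover then have "r_ideal R X" using CA by blast
      ultimately show ?thesis using \<open>r \<in> R\<close> unfolding r_ideal_def by blast
    qed
    moreover have "0 \<in> \<Union>C" "Q \<subseteq> \<Union>C"
    proof -
      obtain X where "X \<in> C" using C(1) by blast
      moreover then have "r_ideal R X" "Q \<subseteq> X" using CA by blast+
      ultimately show "0 \<in> \<Union>C" "Q \<subseteq> \<Union>C" by (auto simp: r_ideal_def)
    qed
    moreover have "\<Union>C \<subseteq> R"
    proof (rule Union_least)
      fix X assume "X \<in> C"
      then have "r_ideal R X" using CA by blast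
      then show "X \<subseteq> R" by (simp add: r_ideal_def)
    qed
    moreover have "1 \<notin> \<Union>C" using CA by blast
    ultimately show "\<Union>C \<in> ?A" by (simp add: r_ideal_def)
  qed
  then obtain P where PA: "P \<in> ?A" and Pmax: "\<forall>X\<in>?A. P \<subseteq> X \<longrightarrow> X = P"
    by (rule bexE)
  have P: "r_ideal R P" "Q \<subseteq> P" "1 \<notin> P" using PA by simp_all
  have max: "X = P" if "r_ideal R X" "1 \<notin> X" "P \<subseteq> X" for X
    using that P(2) by (intro Pmax[rule_format]) auto
  note PD = rmodD[OF P(1)[unfolded r_ideal_iff, THEN conjunct2]]
  have PR: "P \<subseteq> R" using P(1) by (simp add: r_ideal_def)
  \<comment> \<open>Otherwise \<open>P\<close> and \<open>a\<close> together would generate a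
    strictly larger ideal that still misses 1.\<close>
  have ext: "\<exists>p\<in>P. \<exists>r\<in>R. p + r * a = 1" if "a \<in> R" "a \<notin> P" for a
  proof (rule ccontr)
    let ?X = "{p + r * a | p r. p \<in> P \<and> r \<in> R}"
    assume no: "\<not> (\<exists>p\<in>P. \<exists>r\<in>R. p + r * a = 1)"
    have "r_ideal R ?X" unfolding r_ideal_iff
    proof (intro conjI rmodI)
      show "?X \<subseteq> R" using R PR \<open>a \<in> R\<close> unfolding rsub_def by blast
      have "0 = 0 + 0 * a" by simp
      then show "0 \<in> ?X" using PD(1) R unfolding rsub_def by blast
    next
      fix x y assume "x \<in> ?X" "y \<in> ?X"
      then obtain p r q s where "p \<in> P" "r \<in> R" "x = p + r * a" "q \<in> P" "s \<in> R" "y = q + s * a" by blast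
      moreover have "x + y = (p + q) + (r + s) * a" by (simp add: calculation algebra_simps)
      ultimately show "x + y \<in> ?X" using PD(2) R unfolding rsub_def by blast
    next
      fix c x assume "c \<in> R" "x \<in> ?X"
      then obtain p r where "p \<in> P" "r \<in> R" "x = p + r * a" by blast
      moreover have "c * x = c * p + (c * r) * a" by (simp add: calculation algebra_simps)
      ultimately show "c * x \<in> ?X" using PD(3) R \<open>c \<in> R\<close> unfolding rsub_def by blast
    qed
    moreover have "1 \<notin> ?X" using no by force
    moreover have "P \<subseteq> ?X"
    proof
      fix p assume "p \<in> P"
      moreover have "p = p + 0 * a" by simp
      ultimately show "p \<in> ?X" using R unfolding rsub_def by blast
    qed
    ultimately have "?X = P" using max by blast
    moreover have "a = 0 + 1 * a" by simp
    then have "a \<in> ?X" using PD(1) R unfolding rsub_def by blast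
    ultimately show False using \<open>a \<notin> P\<close> by blast
  qed
  have "a \<in> P \<or> b \<in> P" if ab: "a \<in> R" "b \<in> R" "a * b \<in> P" for a b
  proof (rule ccontr)
    assume "\<not> ?thesis"
    with ext ab obtain p r q s where "p \<in> P" "r \<in> R" "p + r * a = 1" "q \<in> P" "s \<in> R" "q + s * b = 1"
      by metis
    \<comment> \<open>After expansion every term has a factor \<open>p\<close>, \<open>q\<close> or
      \<open>a * b\<close>, so 1 would lie in \<open>P\<close>.\<close>
    moreover have "1 = (p + r * a) * (q + s * b)" using calculation by simp
    then have one: "1 = q * p + ((s * b) * p + ((r * a) * q + (r * s) * (a * b)))"
      by (simp add: algebra_simps)
    moreover have "q \<in> R" "s * b \<in> R" "r * a \<in> R" "r * s \<in> R"
      using calculation ab PR R by (auto simp: rsub_def)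
    ultimately have "q * p + (s * b * p + (r * a * q + r * s * (a * b))) \<in> P"
      using ab(3)
      by (intro PD(2) PD(3)[of q p] PD(3)[of "s * b" p] PD(3)[of "r * a" q] PD(3)[of "r * s" "a * b"])
    with P(3) show False by (simp only: one[symmetric])
  qed
  then have "r_prime_ideal R P"
    using P PR R unfolding r_prime_ideal_def rsub_def by blast
  with P(2) show thesis using that by blast
qed

text \<open>Local-global principle: the denominators of \<open>x\<close> with respect to \<open>A\<close> form an ideal
  contained in no prime.\<close>

lemma mem_if_locally_mem:
  assumes R: "rsub R" and A: "rmod R (\<lambda>x. x) A"
    and loc: "\<And>P. r_prime_ideal R P \<Longrightarrow> \<exists>b\<in>R - P. b * x \<in> A"
  shows "x \<in> A"
proof (rule ccontr)
  assume "x \<notin> A"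
  let ?Q = "{r \<in> R. r * x \<in> A}"
  have "r_ideal R ?Q"
    using R rmodD[OF A] by (auto simp: r_ideal_def rsub_def distrib_right mult.assoc)
  moreover have "1 \<notin> ?Q" using \<open>x \<notin> A\<close> by simp
  ultimately obtain P where "r_prime_ideal R P" "?Q \<subseteq> P" using prime_ideal_over[OF R] by blast
  with loc show False by blast
qed

text \<open>If all powers of \<open>t\<close> share the denominator \<open>c\<close>, then
  \<open>t\<close> is integral: the ideals generated by \<open>c\<close>, \<open>t * c\<close>, ...,
  form an ascending chain, which stops because \<open>R\<close> is noetherian. Cancelling
  \<open>c\<close> from the resulting relation leaves a monic equation for \<open>t\<close>, and
  \<open>R\<close> is integrally closed.\<close>

lemma almost_integral_mem:
  assumes R: "dedekind_domain R" and c: "c \<noteq> 0" and tc: "\<And>n. t ^ n * c \<in> R"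
  shows "t \<in> R"
proof -
  have rsub: "rsub R" using R by (simp add: dedekind_domain_def)
  \<comment> \<open>Coefficients indexed by exponents are kept explicit, so that a membership can be
    read off as a polynomial relation.\<close>
  define M where "M n = {(\<Sum>i<n. r i * (t ^ i * c)) | r. \<forall>i<n. r i \<in> R}" for n :: nat
  have MI: "(\<Sum>i<n. r i * (t ^ i * c)) \<in> M n" if "\<forall>i<n. r i \<in> R" for r n
    unfolding M_def using that by blast
  have M: "rmod R (\<lambda>x. x) (M n)" for n
  proof (rule rmodI)
    show "0 \<in> M n" using MI[of n "\<lambda>_. 0"] rsub by (simp add: rsub_def)
  next
    fix x y assume "x \<in> M n" "y \<in> M n"
    then obtain r q where "x = (\<Sum>i<n. r i * (t ^ i * c))" "y = (\<Sum>i<n. q i * (t ^ i * c))"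
      and rq: "\<forall>i<n. r i \<in> R" "\<forall>i<n. q i \<in> R" by (auto simp: M_def)
    then have "x + y = (\<Sum>i<n. (r i + q i) * (t ^ i * c))"
      by (simp add: sum.distrib distrib_right)
    then show "x + y \<in> M n" using MI[of n "\<lambda>i. r i + q i"] rsub rq by (simp add: rsub_def)
  next
    fix a x assume "a \<in> R" "x \<in> M n"
    then obtain r where "x = (\<Sum>i<n. r i * (t ^ i * c))" and r: "\<forall>i<n. r i \<in> R" by (auto simp: M_def)
    then have "a * x = (\<Sum>i<n. (a * r i) * (t ^ i * c))"
      by (simp add: sum_distrib_left mult.assoc)
    then show "a * x \<in> M n" using MI[of n "\<lambda>i. a * r i"] rsub r \<open>a \<in> R\<close> by (simp add: rsub_def)
  qed
  have Msuc: "M n \<subseteq> M (Suc n)" for n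
  proof
    fix x assume "x \<in> M n"
    then obtain r where x: "x = (\<Sum>i<n. r i * (t ^ i * c))" and r: "\<forall>i<n. r i \<in> R"
      by (auto simp: M_def)
    have "(\<Sum>i<Suc n. (r(n := 0)) i * (t ^ i * c)) = x" by (simp add: x)
    moreover have "\<forall>i<Suc n. (r(n := 0)) i \<in> R" using r rsub by (simp add: rsub_def less_Suc_eq)
    ultimately show "x \<in> M (Suc n)" using MI[of "Suc n" "r(n := 0)"] by (simp only:)
  qed
  have Mmono: "m \<le> n \<Longrightarrow> M m \<subseteq> M n" for m n
    using lift_Suc_mono_le[of M, OF Msuc] by blast
  have MR: "M n \<subseteq> R" for n
  proof
    fix x assume "x \<in> M n"
    then obtain r where x: "x = (\<Sum>i<n. r i * (t ^ i * c))" and r: "\<forall>i<n. r i \<in> R"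
      by (auto simp: M_def)
    have "(\<Sum>i<n. r i * (t ^ i * c)) \<in> R"
      using r tc rsub by (induction n) (auto simp: rsub_def)
    then show "x \<in> R" by (simp add: x)
  qed
  have top: "t ^ n * c \<in> M (Suc n)" for n
  proof -
    let ?r = "\<lambda>i. if i = n then (1::'a) else 0"
    have "(\<Sum>i<Suc n. ?r i * (t ^ i * c)) = t ^ n * c" by simp
    moreover have "\<forall>i<Suc n. ?r i \<in> R" using rsub by (simp add: rsub_def)
    ultimately show ?thesis using MI[of "Suc n" ?r] by (simp only:)
  qed
  have U: "r_ideal R (\<Union>n. M n)"
    unfolding r_ideal_iff
  proof (intro conjI rmodI)
    show "(\<Union>n. M n) \<subseteq> R" using MR by (rule UN_least)
    show "0 \<in> (\<Union>n. M n)" using rmodD(1)[OF M] by simp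
    show "r * x \<in> (\<Union>n. M n)" if "r \<in> R" "x \<in> (\<Union>n. M n)" for r x
      using that rmodD(3)[OF M] by auto
  next
    fix x y assume "x \<in> (\<Union>n. M n)" "y \<in> (\<Union>n. M n)"
    then obtain m n where "x \<in> M m" "y \<in> M n" by blast
    then have "x \<in> M (max m n)" "y \<in> M (max m n)"
      using Mmono[of m "max m n"] Mmono[of n "max m n"] by auto
    then show "x + y \<in> (\<Union>n. M n)" using rmodD(2)[OF M] by blast
  qed
  have "r_noetherian R" using R by (simp add: dedekind_domain_def)
  then obtain F where F: "finite F" "F \<subseteq> (\<Union>n. M n)" "(\<Union>n. M n) = rspan R F"
    using U unfolding r_noetherian_def by (elim allE[of _ "\<Union>n. M n"] impE exE conjE)
  have "\<exists>n. F \<subseteq> M n" using F(1,2)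
  proof (induction F)
    case (insert f F)
    then obtain m n where "F \<subseteq> M m" "f \<in> M n" by blast
    then have "insert f F \<subseteq> M (max m n)"
      using Mmono[of m "max m n"] Mmono[of n "max m n"] by auto
    then show ?case by blast
  qed auto
  then obtain n where "F \<subseteq> M n" by blast
  then have "(\<Union>n. M n) \<subseteq> M n" unfolding F(3) rspan_eq_rspanL by (rule rspanL_least[OF M])
  \<comment> \<open>The chain is constant from \<open>n\<close> on, so this element lies even in
    \<open>M n\<close>. Membership in \<open>M (Suc n)\<close> is recorded because it gives
    coefficients for all exponents below \<open>Suc n\<close>, as a monic equation of that degree
    requires.\<close>
  then have "t ^ Suc n * c \<in> M (Suc n)" using top[of "Suc n"] Msuc[of n] by blast
  then obtain r where r: "\<forall>i<Suc n. r i \<in> R" and eq: "t ^ Suc n * c = (\<Sum>i<Suc n. r i * (t ^ i * c))"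
    unfolding M_def by blast
  have "t ^ Suc n * c = (\<Sum>i<Suc n. r i * t ^ i) * c"
    unfolding eq sum_distrib_right by (simp add: mult.assoc)
  then have "t ^ Suc n = (\<Sum>i<Suc n. r i * t ^ i)" using c by (simp only: mult_cancel_right simp_thms)
  then have "t ^ Suc n + (\<Sum>i<Suc n. - r i * t ^ i) = 0"
    by (simp add: sum_negf)
  moreover have "\<forall>i<Suc n. - r i \<in> R" using r rsub_uminus[OF rsub] by blast
  ultimately have "integral_over R t" unfolding integral_over_def
    by (intro exI[of _ "Suc n"] exI[of _ "\<lambda>i. - r i"]) simp
  then show ?thesis using R by (simp add: dedekind_domain_def)
qed

section \<open>Orders and their ideals\<close>

locale quadratic_order = quadratic_algebra emb for emb :: "'k::field \<Rightarrow> 'l::comm_ring_1" +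
  fixes R :: "'k set" and S :: "'l set"
  assumes dedekind: "dedekind_domain R" and quad_alg: "quad_alg R emb S"
begin

abbreviation "lspan \<equiv> rspanL R emb"
abbreviation "prod_ideal I J \<equiv> iprod R emb I J"
abbreviation "inv_ideal \<equiv> invertible_S R emb S"
abbreviation scale :: "'l \<Rightarrow> 'l set \<Rightarrow> 'l set" where "scale \<kappa> I \<equiv> (\<lambda>x. \<kappa> * x) ` I"

lemma rsub: "rsub R" using dedekind by (simp add: dedekind_domain_def)

lemma kalg: "kalg emb" using dim2 by (simp add: dim2_alg_def)

lemma R_0 [simp]: "0 \<in> R" and R_1 [simp]: "1 \<in> R"
  and R_add: "a \<in> R \<Longrightarrow> b \<in> R \<Longrightarrow> a + b \<in> R"
  and R_diff: "a \<in> R \<Longrightarrow> b \<in> R \<Longrightarrow> a - b \<in> R"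
  and R_mult: "a \<in> R \<Longrightarrow> b \<in> R \<Longrightarrow> a * b \<in> R"
  using rsub by (auto simp: rsub_def)

lemma rmod_lspan: "rmod R emb (lspan G)"
  by (rule rmod_rspanL[OF rsub kalg])

lemma lspan_superset: "G \<subseteq> lspan G"
  by (rule rspanL_superset[OF rsub kalg])

lemma rmod_lattice: "lattice R emb M \<Longrightarrow> rmod R emb M"
  by (auto simp: lattice_def rmod_lspan)

lemma lattice_S: "lattice R emb S" and S_1 [simp]: "1 \<in> S"
  and S_mult: "x \<in> S \<Longrightarrow> y \<in> S \<Longrightarrow> x * y \<in> S"
  using quad_alg by (auto simp: quad_alg_def)

lemmas S_mod = rmodD[OF rmod_lattice[OF lattice_S]]

lemma emb_S: "r \<in> R \<Longrightarrow> emb r \<in> S"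
  using S_mod(3)[of r 1] by simp

lemma S_diff: "x \<in> S \<Longrightarrow> y \<in> S \<Longrightarrow> x - y \<in> S"
  using S_mod(2)[of x "- y"] S_mod(3)[of "- 1" y] rsub_uminus[OF rsub R_1] by (simp add: emb_minus)

lemma frac_ideal_S_self: "frac_ideal_S R emb S S"
  by (simp add: frac_ideal_S_def lattice_S S_mult)

text \<open>A product of denominators of the finitely many generators works for the whole span. The
  multiplicative set \<open>T\<close> is a parameter because it will be both the nonzero elements of
  \<open>R\<close> and the complement of a prime.\<close>

lemma common_denominator:
  assumes T: "T \<subseteq> R" "1 \<in> T" "\<And>a b. a \<in> T \<Longrightarrow> b \<in> T \<Longrightarrow> a * b \<in> T"
    and M: "rmod R emb M" and F: "finite F" and \<psi>: "klinear emb \<psi>"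
    and den: "\<And>g. g \<in> F \<Longrightarrow> \<exists>b\<in>T. emb b * \<psi> g \<in> M"
  shows "\<exists>b\<in>T. \<forall>x\<in>lspan F. emb b * \<psi> x \<in> M"
proof -
  have "\<exists>b\<in>T. \<forall>x\<in>F. emb b * \<psi> x \<in> M" using F den
  proof (induction F)
    case empty
    then show ?case using T(2) by blast
  next
    case (insert g F)
    then obtain b where b: "b \<in> T" "\<forall>x\<in>F. emb b * \<psi> x \<in> M" by blast
    obtain c where c: "c \<in> T" "emb c * \<psi> g \<in> M" using insert.prems by blast
    have "emb (b * c) * \<psi> x \<in> M" if "x \<in> insert g F" for x
    proof -
      have "emb (b * c) * \<psi> x = emb c * (emb b * \<psi> x)" "emb (b * c) * \<psi> x = emb b * (emb c * \<psi> x)"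
        by (simp_all add: emb_mult mult.assoc mult.left_commute)
      then show ?thesis using that b c T(1) rmodD(3)[OF M] by (metis insertE subsetD)
    qed
    then show ?case using T(3) b c by blast
  qed
  then obtain b where b: "b \<in> T" "\<forall>x\<in>F. emb b * \<psi> x \<in> M" by blast
  have "\<psi> 0 = 0" using klinear_scale[OF \<psi>, of 0 0] by simp
  then have "rmod R emb {x. emb b * \<psi> x \<in> M}"
    by (intro rmodI) (auto simp: rmodD[OF M] klinear_add[OF \<psi>] klinear_scale[OF \<psi>] distrib_left
      mult.left_commute[of "emb b"])
  then have "lspan F \<subseteq> {x. emb b * \<psi> x \<in> M}"
    by (rule rspanL_least) (use b(2) in blast)
  with b(1) show ?thesis by blast
qed

lemma lattice_scale_into:
  assumes "lattice R emb I" "rmod R emb M" "\<And>x. \<exists>d\<in>R. d \<noteq> 0 \<and> emb d * x \<in> M"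
  obtains d where "d \<in> R" "d \<noteq> 0" "\<And>x. x \<in> I \<Longrightarrow> emb d * x \<in> M"
proof -
  obtain F where F: "finite F" "I = lspan F" using assms(1) by (auto simp: lattice_def)
  have "klinear emb (\<lambda>x. x)" by (simp add: klinear_def)
  moreover have "\<exists>b\<in>R - {0}. emb b * g \<in> M" for g using assms(3)[of g] by blast
  ultimately have "\<exists>b\<in>R - {0}. \<forall>x\<in>lspan F. emb b * x \<in> M"
    using R_mult by (intro common_denominator[where \<psi> = "\<lambda>x. x"] assms(2) F(1)) auto
  then show thesis using that F(2) by blast
qed

text \<open>\<open>S\<close> need not have an \<open>R\<close>-basis, so the determinant cannot be
  read off from a matrix over \<open>R\<close>. Instead, all iterates of \<open>\<psi>\<close>
  preserve \<open>S\<close>, hence all powers of the determinant share one denominator, and almost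
  integral elements lie in \<open>R\<close>.\<close>

lemma detL_mem_R:
  assumes \<psi>: "klinear emb \<psi>" and S: "\<And>x. x \<in> S \<Longrightarrow> \<psi> x \<in> S"
  shows "detL emb \<psi> \<in> R"
proof -
  \<comment> \<open>A free comparison lattice, spanned over \<open>R\<close> by the chosen basis of
    the algebra.\<close>
  let ?M = "{x. fst (coord emb x) \<in> R \<and> snd (coord emb x) \<in> R}"
  have M: "rmod R emb ?M"
  proof (rule rmodI)
    show "x + y \<in> ?M" if "x \<in> ?M" "y \<in> ?M" for x y
      using that coord_lin[of 1 x y] by (simp add: R_add)
    show "emb r * x \<in> ?M" if "r \<in> R" "x \<in> ?M" for r x
      using that coord_lin[of r x 0] by (simp add: R_mult)
  qed simp
  have frac: "\<exists>d\<in>R. d \<noteq> 0 \<and> d * a \<in> R" for a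
  proof -
    obtain p q where "p \<in> R" "q \<in> R" "q \<noteq> 0" "a = p / q"
      using dedekind unfolding dedekind_domain_def frac_field_of_def by blast
    then show ?thesis by (intro bexI[of _ q]) auto
  qed
  have "\<exists>d\<in>R. d \<noteq> 0 \<and> emb d * x \<in> ?M" for x
  proof -
    obtain p q where pq: "p \<in> R" "p \<noteq> 0" "p * fst (coord emb x) \<in> R" "q \<in> R" "q \<noteq> 0"
      "q * snd (coord emb x) \<in> R" using frac by metis
    have "q * (p * fst (coord emb x)) \<in> R" "p * (q * snd (coord emb x)) \<in> R"
      using pq R_mult by auto
    then have "emb (p * q) * x \<in> ?M"
      using coord_lin[of "p * q" x 0] by (simp add: mult.assoc mult.left_commute)
    then show ?thesis using pq R_mult by (intro bexI[of _ "p * q"]) auto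
  qed
  then obtain d where d: "d \<in> R" "d \<noteq> 0" "\<And>x. x \<in> S \<Longrightarrow> emb d * x \<in> ?M"
    using lattice_scale_into[OF lattice_S M] by blast
  \<comment> \<open>Multiples of the basis vectors inside \<open>S\<close> give an independent pair;
    its determinant \<open>?w\<close> enters the common denominator.\<close>
  obtain p q where pq: "p \<noteq> 0" "q \<noteq> 0" "emb p * e1 \<in> S" "emb q * e2 \<in> S"
    using lattice_S unfolding lattice_def by metis
  let ?w = "detpair emb (emb p * e1) (emb q * e2)"
  have w: "?w \<noteq> 0"
    using pq coord_lin[of p e1 0] coord_lin[of q e2 0] by (simp add: detpair_def)
  have pow: "klinear emb (\<psi> ^^ n) \<and> detL emb (\<psi> ^^ n) = detL emb \<psi> ^ n \<and> (\<forall>x\<in>S. (\<psi> ^^ n) x \<in> S)" for n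
  proof (induction n)
    case 0
    then show ?case by (simp add: klinear_def detL_id id_def)
  next
    case (Suc n)
    then show ?case
      using klinear_comp[OF \<psi>, of "\<psi> ^^ n"] detL_comp[OF \<psi>, of "\<psi> ^^ n"] S by (simp add: comp_def)
  qed
  \<comment> \<open>The \<open>n\<close>-th iterate multiplies \<open>?w\<close> by the
    \<open>n\<close>-th power of the determinant. Both image vectors stay in \<open>S\<close>, so
    one factor \<open>d\<close> for each moves them into the comparison lattice, where determinants
    lie in \<open>R\<close>.\<close>
  have "detL emb \<psi> ^ n * (d * d * ?w) \<in> R" for n
  proof -
    define u where "u = (\<psi> ^^ n) (emb p * e1)"
    define v where "v = (\<psi> ^^ n) (emb q * e2)"
    have "emb d * u \<in> ?M" "emb d * v \<in> ?M" unfolding u_def v_def using pow pq(3,4) d(3) by blast+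
    then have "detpair emb (emb d * u) (emb d * v) \<in> R"
      by (simp add: detpair_def R_diff R_mult)
    moreover have "detpair emb (emb d * u) (emb d * v) = d * (d * detpair emb u v)"
      using coord_lin[of d u 0] coord_lin[of d v 0] by (simp add: detpair_def algebra_simps)
    moreover have "detpair emb u v = detL emb \<psi> ^ n * ?w"
      unfolding u_def v_def using pow detpair_klinear by simp
    ultimately show ?thesis by (simp add: algebra_simps)
  qed
  then show ?thesis using almost_integral_mem[OF dedekind, of "d * d * ?w"] d(2) w by simp
qed

lemma N_mem_R: "x \<in> S \<Longrightarrow> N x \<in> R"
  unfolding normL_def by (rule detL_mem_R[OF klinear_mult]) (rule S_mult)

lemma B_mem_R: "x \<in> S \<Longrightarrow> y \<in> S \<Longrightarrow> B x y \<in> R"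
  by (simp add: B_def N_mem_R S_mod R_diff)

lemma cj_mem_S: "x \<in> S \<Longrightarrow> cj x \<in> S"
  by (simp add: cj_def trace_def S_diff emb_S N_mem_R R_diff S_mod)

lemma emb_N_mem:
  assumes "frac_ideal_S R emb S I" "I \<subseteq> S" "x \<in> I" shows "emb (N x) \<in> I"
proof -
  have "cj x * x \<in> I" using assms cj_mem_S[of x] by (auto simp: frac_ideal_S_def)
  moreover have "cj x * x = emb (N x)" by (subst mult.commute) (rule mult_cj)
  ultimately show ?thesis by simp
qed

subsection \<open>Products and multiples of ideals\<close>

lemma rmod_prod_ideal: "rmod R emb (prod_ideal I J)"
  unfolding iprod_def by (rule rmod_lspan)

lemma mem_prod_ideal: "x \<in> I \<Longrightarrow> y \<in> J \<Longrightarrow> x * y \<in> prod_ideal I J"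
  unfolding iprod_def by (rule subsetD[OF lspan_superset]) blast

lemma prod_ideal_least:
  assumes "rmod R emb M" "\<And>x y. x \<in> I \<Longrightarrow> y \<in> J \<Longrightarrow> x * y \<in> M"
  shows "prod_ideal I J \<subseteq> M"
  unfolding iprod_def using assms by (intro rspanL_least) auto

lemma rmod_mult_preimage:
  assumes "rmod R emb M" shows "rmod R emb {x. x * z \<in> M}"
  by (rule rmodI) (auto simp: rmodD[OF assms] distrib_right mult.assoc)

lemma prod_ideal_commute: "prod_ideal I J = prod_ideal J I"
proof -
  have "prod_ideal I J \<subseteq> prod_ideal J I" for I J
    by (rule prod_ideal_least[OF rmod_prod_ideal]) (subst mult.commute, rule mem_prod_ideal)
  then show ?thesis by blast
qed

lemma prod_ideal_assoc: "prod_ideal (prod_ideal I J) K = prod_ideal I (prod_ideal J K)"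
proof -
  have 1: "prod_ideal (prod_ideal I J) K \<subseteq> prod_ideal I (prod_ideal J K)" for I J K
  proof (rule prod_ideal_least[OF rmod_prod_ideal])
    fix w z assume w: "w \<in> prod_ideal I J" and z: "z \<in> K"
    have "prod_ideal I J \<subseteq> {x. x * z \<in> prod_ideal I (prod_ideal J K)}"
      by (rule prod_ideal_least[OF rmod_mult_preimage[OF rmod_prod_ideal]])
        (use z in \<open>auto simp: mult.assoc intro!: mem_prod_ideal\<close>)
    with w show "w * z \<in> prod_ideal I (prod_ideal J K)" by blast
  qed
  \<comment> \<open>By commutativity, the reverse inclusion is the one just proved with the order of
    the three factors reversed.\<close>
  have "prod_ideal I (prod_ideal J K) = prod_ideal (prod_ideal K J) I"
    by (subst prod_ideal_commute, subst prod_ideal_commute[of J], rule refl)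
  also have "\<dots> \<subseteq> prod_ideal K (prod_ideal J I)" by (rule 1)
  also have "\<dots> = prod_ideal (prod_ideal I J) K"
    by (subst prod_ideal_commute, subst prod_ideal_commute[of J], rule refl)
  finally show ?thesis using 1[of I J K] by blast
qed

lemma prod_ideal_left_commute: "prod_ideal I (prod_ideal J K) = prod_ideal J (prod_ideal I K)"
  by (simp only: prod_ideal_assoc[symmetric] prod_ideal_commute[of I J])

lemmas prod_ideal_ac = prod_ideal_assoc prod_ideal_commute prod_ideal_left_commute

lemma frac_ideal_rmod: "frac_ideal_S R emb S I \<Longrightarrow> rmod R emb I"
  by (simp add: frac_ideal_S_def rmod_lattice)

lemma prod_ideal_S: "frac_ideal_S R emb S I \<Longrightarrow> prod_ideal S I = I"
proof
  assume I: "frac_ideal_S R emb S I"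
  show "prod_ideal S I \<subseteq> I"
    using I by (intro prod_ideal_least frac_ideal_rmod) (auto simp: frac_ideal_S_def)
  show "I \<subseteq> prod_ideal S I" using mem_prod_ideal[of 1 S _ I] by auto
qed

lemma klinear_image_lspan:
  assumes "klinear emb \<psi>"
  shows "\<psi> ` lspan G = lspan (\<psi> ` G)"
proof
  have \<psi>0: "\<psi> 0 = 0" using klinear_scale[OF assms, of 0 0] by simp
  have "rmod R emb {x. \<psi> x \<in> lspan (\<psi> ` G)}"
    by (rule rmodI) (auto simp: \<psi>0 klinear_add[OF assms] klinear_scale[OF assms] rmodD[OF rmod_lspan])
  then have "lspan G \<subseteq> {x. \<psi> x \<in> lspan (\<psi> ` G)}"
    by (rule rspanL_least) (use lspan_superset in blast)
  then show "\<psi> ` lspan G \<subseteq> lspan (\<psi> ` G)" by blast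
  have "rmod R emb (\<psi> ` lspan G)"
  proof (rule rmodI)
    show "0 \<in> \<psi> ` lspan G" using \<psi>0 rmodD(1)[OF rmod_lspan] by (metis image_eqI)
    show "x + y \<in> \<psi> ` lspan G" if "x \<in> \<psi> ` lspan G" "y \<in> \<psi> ` lspan G" for x y
      using that rmodD(2)[OF rmod_lspan] by (auto simp: klinear_add[OF assms, symmetric])
    show "emb r * x \<in> \<psi> ` lspan G" if "r \<in> R" "x \<in> \<psi> ` lspan G" for r x
      using that rmodD(3)[OF rmod_lspan] by (auto simp: klinear_scale[OF assms, symmetric])
  qed
  then show "lspan (\<psi> ` G) \<subseteq> \<psi> ` lspan G"
    by (rule rspanL_least) (use lspan_superset in blast)
qed

lemma scale_scale: "scale \<kappa> (scale \<mu> I) = scale (\<kappa> * \<mu>) I"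
  by (simp add: image_image mult.assoc)

lemma scale_1 [simp]: "scale 1 I = I"
  by simp

lemma prod_ideal_scale: "prod_ideal (scale \<kappa> I) J = scale \<kappa> (prod_ideal I J)"
proof -
  have "{x * y |x y. x \<in> scale \<kappa> I \<and> y \<in> J} = scale \<kappa> {x * y |x y. x \<in> I \<and> y \<in> J}"
  proof (intro equalityI subsetI)
    fix z assume "z \<in> {x * y |x y. x \<in> scale \<kappa> I \<and> y \<in> J}"
    then obtain x y where "x \<in> I" "y \<in> J" "z = \<kappa> * x * y" by blast
    moreover then have "z = \<kappa> * (x * y)" by (simp only: mult.assoc)
    ultimately show "z \<in> scale \<kappa> {x * y |x y. x \<in> I \<and> y \<in> J}" by blast
  next
    fix z assume "z \<in> scale \<kappa> {x * y |x y. x \<in> I \<and> y \<in> J}"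
    then obtain x y where "x \<in> I" "y \<in> J" "z = \<kappa> * (x * y)" by blast
    moreover then have "z = (\<kappa> * x) * y" by (simp only: mult.assoc)
    ultimately show "z \<in> {x * y |x y. x \<in> scale \<kappa> I \<and> y \<in> J}" by blast
  qed
  then show ?thesis
    unfolding iprod_def klinear_image_lspan[OF klinear_mult] by (simp only:)
qed

lemma prod_ideal_scale2: "prod_ideal (scale \<kappa> I) (scale \<mu> J) = scale (\<kappa> * \<mu>) (prod_ideal I J)"
  by (simp only: prod_ideal_scale prod_ideal_commute[of I "scale \<mu> J"] scale_scale
    prod_ideal_commute[of J I])

lemma lattice_scale:
  assumes "lattice R emb I" "Lunit \<kappa>"
  shows "lattice R emb (scale \<kappa> I)"
  unfolding lattice_def
proof (intro conjI allI)
  obtain F where "finite F" "I = lspan F" using assms(1) by (auto simp: lattice_def)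
  then show "\<exists>F. finite F \<and> scale \<kappa> I = lspan F"
    by (intro exI[of _ "scale \<kappa> F"]) (simp add: klinear_image_lspan[OF klinear_mult])
  obtain \<mu> where \<mu>: "\<kappa> * \<mu> = 1" using assms(2) by (auto simp: Lunit_def)
  fix x
  obtain d where d: "d \<in> R" "d \<noteq> 0" "emb d * (\<mu> * x) \<in> I" using assms(1) by (auto simp: lattice_def)
  have "emb d * x = \<kappa> * (emb d * (\<mu> * x))"
  proof -
    have "\<kappa> * (emb d * (\<mu> * x)) = (\<kappa> * \<mu>) * (emb d * x)" by (simp add: algebra_simps)
    then show ?thesis by (simp add: \<mu>)
  qed
  then show "\<exists>d\<in>R. d \<noteq> 0 \<and> emb d * x \<in> scale \<kappa> I" using d by blast
qed

lemma frac_ideal_scale: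
  assumes "frac_ideal_S R emb S I" "Lunit \<kappa>"
  shows "frac_ideal_S R emb S (scale \<kappa> I)"
  unfolding frac_ideal_S_def
proof (intro conjI ballI)
  show "lattice R emb (scale \<kappa> I)" using assms lattice_scale by (simp add: frac_ideal_S_def)
  fix x y assume "x \<in> S" "y \<in> scale \<kappa> I"
  then obtain z where "z \<in> I" "y = \<kappa> * z" by blast
  moreover then have "x * z \<in> I" using assms(1) \<open>x \<in> S\<close> by (simp add: frac_ideal_S_def)
  moreover have "x * (\<kappa> * z) = \<kappa> * (x * z)" by (rule mult.left_commute)
  ultimately show "x * y \<in> scale \<kappa> I" by blast
qed

lemma inv_ideal_frac: "inv_ideal I \<Longrightarrow> frac_ideal_S R emb S I"
  by (simp add: invertible_S_def)

lemma inv_ideal_S: "inv_ideal S"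
  unfolding invertible_S_def
  by (intro conjI exI[of _ S] frac_ideal_S_self prod_ideal_S)

lemma inv_ideal_scale:
  assumes "inv_ideal I" "Lunit \<kappa>"
  shows "inv_ideal (scale \<kappa> I)"
proof -
  obtain \<mu> where \<mu>: "\<kappa> * \<mu> = 1" using assms(2) by (auto simp: Lunit_def)
  then have "Lunit \<mu>" unfolding Lunit_def by (metis mult.commute)
  obtain J where J: "frac_ideal_S R emb S J" "prod_ideal I J = S"
    using assms(1) by (auto simp: invertible_S_def)
  have "prod_ideal (scale \<kappa> I) (scale \<mu> J) = S" by (simp add: prod_ideal_scale2 J(2) \<mu>)
  then show ?thesis
    using assms J frac_ideal_scale \<open>Lunit \<mu>\<close> unfolding invertible_S_def by blast
qed

text \<open>Finite generation is by products of generators. Denominators multiply, and on the side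
  of \<open>J\<close> a nonzero multiple of 1 suffices.\<close>

lemma frac_ideal_prod:
  assumes I: "frac_ideal_S R emb S I" and J: "frac_ideal_S R emb S J"
  shows "frac_ideal_S R emb S (prod_ideal I J)"
  unfolding frac_ideal_S_def lattice_def
proof (intro conjI allI ballI)
  obtain F where F: "finite F" "I = lspan F" using I unfolding frac_ideal_S_def lattice_def by blast
  obtain G where G: "finite G" "J = lspan G" using J unfolding frac_ideal_S_def lattice_def by blast
  note FG = F G
  let ?H = "(\<lambda>(x, y). x * y) ` (F \<times> G)"
  have "prod_ideal I J = lspan ?H"
  proof
    \<comment> \<open>Bilinearity is used one variable at a time: first a generator of
      \<open>I\<close> against all of \<open>J\<close>, then an arbitrary element of
      \<open>I\<close>.\<close>
    have *: "f * y \<in> lspan ?H" if "f \<in> F" "y \<in> J" for f y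
    proof -
      have "lspan G \<subseteq> {y. y * f \<in> lspan ?H}"
      proof (rule rspanL_least[OF rmod_mult_preimage[OF rmod_lspan]], rule subsetI, rule CollectI)
        fix g assume "g \<in> G"
        then have "f * g \<in> ?H" using \<open>f \<in> F\<close> by force
        then show "g * f \<in> lspan ?H" using lspan_superset by (metis mult.commute subsetD)
      qed
      then have "y * f \<in> lspan ?H" using that FG by blast
      then show ?thesis by (simp add: mult.commute)
    qed
    show "prod_ideal I J \<subseteq> lspan ?H"
    proof (rule prod_ideal_least[OF rmod_lspan])
      fix x y assume "x \<in> I" "y \<in> J"
      have "lspan F \<subseteq> {x. x * y \<in> lspan ?H}"
        by (rule rspanL_least[OF rmod_mult_preimage[OF rmod_lspan]]) (use * \<open>y \<in> J\<close> in blast)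
      then show "x * y \<in> lspan ?H" using \<open>x \<in> I\<close> FG by blast
    qed
    have "F \<subseteq> I" "G \<subseteq> J" using FG lspan_superset by auto
    then show "lspan ?H \<subseteq> prod_ideal I J"
      by (intro rspanL_least[OF rmod_prod_ideal]) (auto intro: mem_prod_ideal)
  qed
  moreover have "finite ?H" using FG by simp
  ultimately show "\<exists>F. finite F \<and> prod_ideal I J = lspan F" by blast
next
  fix x
  obtain c where c: "c \<in> R" "c \<noteq> 0" "emb c * x \<in> I" using I unfolding frac_ideal_S_def lattice_def by blast
  obtain d where d: "d \<in> R" "d \<noteq> 0" "emb d * 1 \<in> J"
    using J unfolding frac_ideal_S_def lattice_def by blast
  have "emb (c * d) * x = (emb c * x) * (emb d * 1)" by (simp add: emb_mult algebra_simps)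
  then have "emb (c * d) * x \<in> prod_ideal I J" using c d by (simp only: mem_prod_ideal)
  then show "\<exists>d\<in>R. d \<noteq> 0 \<and> emb d * x \<in> prod_ideal I J"
    using c d R_mult by (intro bexI[of _ "c * d"]) auto
next
  fix x y assume x: "x \<in> S" and y: "y \<in> prod_ideal I J"
  have "prod_ideal I J \<subseteq> {y. y * x \<in> prod_ideal I J}"
  proof (rule prod_ideal_least[OF rmod_mult_preimage[OF rmod_prod_ideal]])
    fix u v assume "u \<in> I" "v \<in> J"
    then have "(x * u) * v \<in> prod_ideal I J" using x I by (intro mem_prod_ideal) (auto simp: frac_ideal_S_def)
    then show "u * v \<in> {y. y * x \<in> prod_ideal I J}" by (simp add: mult.assoc mult.commute mult.left_commute)
  qed
  then show "x * y \<in> prod_ideal I J" using y by (auto simp: mult.commute)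
qed

lemma inv_ideal_prod:
  assumes "inv_ideal I" "inv_ideal J" shows "inv_ideal (prod_ideal I J)"
proof -
  obtain I' J' where *: "frac_ideal_S R emb S I'" "prod_ideal I I' = S"
    "frac_ideal_S R emb S J'" "prod_ideal J J' = S" using assms by (auto simp: invertible_S_def)
  have "prod_ideal (prod_ideal I J) (prod_ideal I' J') = prod_ideal (prod_ideal I I') (prod_ideal J J')"
    by (simp only: prod_ideal_ac)
  also have "\<dots> = S" by (simp add: * prod_ideal_S frac_ideal_S_self)
  finally show ?thesis unfolding invertible_S_def
    by (intro conjI exI[of _ "prod_ideal I' J'"] frac_ideal_prod inv_ideal_frac assms *)
qed

section \<open>The norm ideal\<close>

definition norm_ideal :: "'l set \<Rightarrow> 'k set" where
  "norm_ideal I = rspan R (N ` I)"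

abbreviation "kmod \<equiv> rmod R (\<lambda>x. x)"

lemma kmod_norm_ideal: "kmod (norm_ideal I)"
  unfolding norm_ideal_def rspan_eq_rspanL by (rule rmod_rspanL[OF rsub kalg_id])

lemma N_mem_norm_ideal: "x \<in> I \<Longrightarrow> N x \<in> norm_ideal I"
  unfolding norm_ideal_def rspan_eq_rspanL
  by (rule subsetD[OF rspanL_superset[OF rsub kalg_id]]) (rule imageI)

lemma norm_ideal_least: "kmod A \<Longrightarrow> (\<And>x. x \<in> I \<Longrightarrow> N x \<in> A) \<Longrightarrow> norm_ideal I \<subseteq> A"
  unfolding norm_ideal_def rspan_eq_rspanL by (rule rspanL_least) blast+

lemma kmod_diff:
  assumes "kmod A" "a \<in> A" "b \<in> A" shows "a - b \<in> A"
  using rmodD(2)[OF assms(1,2), of "(- 1) * b"] rmodD(3)[OF assms(1) _ assms(3), of "- 1"]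
    rsub_uminus[OF rsub R_1] by simp

lemma kmod_R: "kmod R"
  by (rule rmodI) (auto simp: R_add R_mult)

lemma kmod_image:
  assumes "kmod A" shows "kmod ((\<lambda>r. c * r) ` A)"
proof (rule rmodI)
  show "0 \<in> (\<lambda>r. c * r) ` A" using rmodD(1)[OF assms] by (metis image_eqI mult_zero_right)
  show "x + y \<in> (\<lambda>r. c * r) ` A" if "x \<in> (\<lambda>r. c * r) ` A" "y \<in> (\<lambda>r. c * r) ` A" for x y
    using that rmodD(2)[OF assms] by (auto simp: distrib_left[symmetric])
  show "r * x \<in> (\<lambda>r. c * r) ` A" if rx: "r \<in> R" "x \<in> (\<lambda>r. c * r) ` A" for r x
  proof -
    obtain a where a: "a \<in> A" "x = c * a" using rx by blast
    have "r * (c * a) = c * (r * a)" by (rule mult.left_commute)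
    moreover have "r * a \<in> A" using rx a rmodD(3)[OF assms] by blast
    ultimately show ?thesis unfolding a by blast
  qed
qed

lemma kmod_preimage: "kmod A \<Longrightarrow> kmod {r. c * r \<in> A}"
  by (rule rmodI) (auto simp: rmodD[where M = A and emb = "\<lambda>x. x"] distrib_left mult.left_commute[of c])

lemma norm_ideal_S: "norm_ideal S = R"
proof
  show "norm_ideal S \<subseteq> R" by (rule norm_ideal_least[OF kmod_R N_mem_R])
  have "1 \<in> norm_ideal S" using N_mem_norm_ideal[OF S_1] by simp
  then show "R \<subseteq> norm_ideal S" using rmodD(3)[OF kmod_norm_ideal, of _ 1] by auto
qed

lemma norm_ideal_scale: "norm_ideal (scale \<kappa> I) = (\<lambda>r. N \<kappa> * r) ` norm_ideal I"
proof
  show "norm_ideal (scale \<kappa> I) \<subseteq> (\<lambda>r. N \<kappa> * r) ` norm_ideal I"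
    by (rule norm_ideal_least[OF kmod_image[OF kmod_norm_ideal]])
      (auto simp: N_mult intro: N_mem_norm_ideal)
  have "norm_ideal I \<subseteq> {r. N \<kappa> * r \<in> norm_ideal (scale \<kappa> I)}"
  proof (rule norm_ideal_least[OF kmod_preimage[OF kmod_norm_ideal]])
    fix x assume "x \<in> I"
    then have "N (\<kappa> * x) \<in> norm_ideal (scale \<kappa> I)" by (intro N_mem_norm_ideal imageI)
    then show "N x \<in> {r. N \<kappa> * r \<in> norm_ideal (scale \<kappa> I)}" by (simp add: N_mult)
  qed
  then show "(\<lambda>r. N \<kappa> * r) ` norm_ideal I \<subseteq> norm_ideal (scale \<kappa> I)" by blast
qed

text \<open>The scalars whose image lies in \<open>I\<close> form an \<open>R\<close>-module
  containing every norm from \<open>I\<close>, hence the whole norm ideal and in particular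
  1.\<close>

lemma eq_S_if_norm_ideal_eq_R:
  assumes I: "frac_ideal_S R emb S I" "I \<subseteq> S" and "1 \<in> norm_ideal I"
  shows "I = S"
proof -
  note I_mod = rmodD[OF frac_ideal_rmod[OF I(1)]]
  have "kmod {r. emb r \<in> I}" by (rule rmodI) (auto simp: I_mod emb_add emb_mult)
  then have "norm_ideal I \<subseteq> {r. emb r \<in> I}" by (rule norm_ideal_least) (simp add: emb_N_mem[OF I])
  then have "1 \<in> I" using assms(3) by auto
  moreover have "x * 1 \<in> I" if "1 \<in> I" "x \<in> S" for x
    using I(1) that unfolding frac_ideal_S_def by blast
  ultimately show ?thesis using I(2) by auto
qed

text \<open>The norm of a sum of products expands into norms and \<open>B\<close>-values of pure
  products, so only these have to be controlled. \<open>A\<close> is left general: it will be a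
  principal module for multiplicativity and a prime ideal for local generators.\<close>

lemma N_prod_ideal_mem:
  assumes A: "kmod A" and NA: "\<And>x y. x \<in> I \<Longrightarrow> y \<in> J \<Longrightarrow> N (x * y) \<in> A"
    and BA: "\<And>x y x' y'. x \<in> I \<Longrightarrow> y \<in> J \<Longrightarrow> x' \<in> I \<Longrightarrow> y' \<in> J \<Longrightarrow> B (x * y) (x' * y') \<in> A"
    and z: "z \<in> prod_ideal I J"
  shows "N z \<in> A"
proof -
  note AD = rmodD[OF A] and PD = rmodD[OF rmod_prod_ideal[of I J]]
  have Bmod: "rmod R emb {w. B u w \<in> A}" for u
    by (rule rmodI) (auto simp: AD B_add B_scale)
  \<comment> \<open>The norm condition alone is not closed under addition; the condition on
    \<open>B\<close> against all of the product is what makes \<open>?M\<close> a module.\<close>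
  let ?M = "{z \<in> prod_ideal I J. N z \<in> A \<and> (\<forall>w\<in>prod_ideal I J. B z w \<in> A)}"
  have "prod_ideal I J \<subseteq> ?M"
  proof (rule prod_ideal_least)
    show "rmod R emb ?M"
    proof (rule rmodI)
      show "0 \<in> ?M" by (simp add: PD AD B_commute[of 0])
      show "x + y \<in> ?M" if "x \<in> ?M" "y \<in> ?M" for x y
        using that by (auto simp: PD AD N_add B_add_left)
      show "emb r * x \<in> ?M" if "r \<in> R" "x \<in> ?M" for r x
        using that by (auto simp: PD AD N_mult N_emb mult.assoc B_scale_left)
    qed
    fix x y assume xy: "x \<in> I" "y \<in> J"
    have "prod_ideal I J \<subseteq> {w. B (x * y) w \<in> A}"
      by (rule prod_ideal_least[OF Bmod]) (simp add: BA xy)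
    then show "x * y \<in> ?M" using NA xy mem_prod_ideal[OF xy] by blast
  qed
  with z show ?thesis by blast
qed

lemma monic_quadratic_mem_R:
  assumes "p \<in> R" "q \<in> R" "x * x - p * x + q = 0"
  shows "x \<in> R"
proof -
  let ?c = "\<lambda>i::nat. if i = 0 then q else - p"
  have "x ^ 2 + (\<Sum>i<2. ?c i * x ^ i) = 0"
    using assms(3) by (simp add: numeral_2_eq_2 algebra_simps)
  moreover have "\<forall>i<2. ?c i \<in> R" using assms rsub_uminus[OF rsub] by simp
  ultimately have "integral_over R x" unfolding integral_over_def
    by (intro exI[of _ 2] exI[of _ ?c]) simp
  then show ?thesis using dedekind by (simp add: dedekind_domain_def)
qed

lemma four_mem_R: "4 \<in> R"
  using R_add[OF R_add[OF R_1 R_1] R_add[OF R_1 R_1]] by simp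

text \<open>With principal norm ideals the generators can be divided out, and the
  \<open>B\<close>-values on products become roots of monic quadratics over the integrally closed
  ring \<open>R\<close>.\<close>

lemma norm_ideal_prod:
  assumes I: "frac_ideal_S R emb S I" and J: "frac_ideal_S R emb S J"
    and s: "s \<noteq> 0" "norm_ideal I = (\<lambda>r. s * r) ` R" and t: "t \<noteq> 0" "norm_ideal J = (\<lambda>r. t * r) ` R"
  shows "norm_ideal (prod_ideal I J) = (\<lambda>r. s * t * r) ` R"
proof
  let ?A = "(\<lambda>r. s * t * r) ` R"
  have A: "kmod ?A" by (rule kmod_image[OF kmod_R])
  have NI: "\<exists>r\<in>R. N x = s * r" if "x \<in> I" for x using N_mem_norm_ideal[OF that] unfolding s by blast
  have NJ: "\<exists>r\<in>R. N x = t * r" if "x \<in> J" for x using N_mem_norm_ideal[OF that] unfolding t by blast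
  have BI: "\<exists>r\<in>R. B x y = s * r" if "x \<in> I" "y \<in> I" for x y
  proof -
    have "x + y \<in> I" using that rmodD(2)[OF frac_ideal_rmod[OF I]] by blast
    then have "B x y \<in> norm_ideal I"
      unfolding B_def using that by (intro kmod_diff kmod_norm_ideal N_mem_norm_ideal)
    then show ?thesis unfolding s by blast
  qed
  have BJ: "\<exists>r\<in>R. B x y = t * r" if "x \<in> J" "y \<in> J" for x y
  proof -
    have "x + y \<in> J" using that rmodD(2)[OF frac_ideal_rmod[OF J]] by blast
    then have "B x y \<in> norm_ideal J"
      unfolding B_def using that by (intro kmod_diff kmod_norm_ideal N_mem_norm_ideal)
    then show ?thesis unfolding t by blast
  qed
  show "norm_ideal (prod_ideal I J) \<subseteq> ?A"
  proof (rule norm_ideal_least[OF A], rule N_prod_ideal_mem[OF A])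
    fix x y assume "x \<in> I" "y \<in> J"
    then obtain a b where "a \<in> R" "b \<in> R" "N x = s * a" "N y = t * b" using NI NJ by blast
    moreover then have "N (x * y) = s * t * (a * b)" by (simp add: N_mult)
    ultimately show "N (x * y) \<in> ?A" using R_mult by blast
  next
    fix x y x' y' assume xy: "x \<in> I" "y \<in> J" "x' \<in> I" "y' \<in> J"
    obtain a where a: "a \<in> R" "N x = s * a" using NI xy by blast
    obtain a' where a': "a' \<in> R" "N x' = s * a'" using NI xy by blast
    obtain b where b: "b \<in> R" "N y = t * b" using NJ xy by blast
    obtain b' where b': "b' \<in> R" "N y' = t * b'" using NJ xy by blast
    obtain c where c: "c \<in> R" "B x x' = s * c" using BI xy by blast
    obtain d where d: "d \<in> R" "B y y' = t * d" using BJ xy by blast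
    define u where "u = B (x * y) (x' * y') / (s * t)"
    define u' where "u' = B (x * y') (x' * y) / (s * t)"
    have u: "B (x * y) (x' * y') = s * t * u" "B (x * y') (x' * y) = s * t * u'"
      using s(1) t(1) by (simp_all add: u_def u'_def)
    \<comment> \<open>The right-hand side of \<open>B_products_mult\<close> after division by the
      square of \<open>s * t\<close>, that is, the product of the two roots \<open>u\<close> and
      \<open>u'\<close>.\<close>
    define q where "q = b * b' * (c * c) + a * a' * (d * d) - 4 * (a * b * (a' * b'))"
    have "s * t * (u + u') = s * t * (c * d)"
      using B_products_sum[of x y x' y'] unfolding u c d by (simp add: algebra_simps)
    then have sum: "u + u' = c * d" using s(1) t(1) by simp
    have "(s * t) * (s * t) * (u * u') = (s * t) * (s * t) * q"
      using B_products_mult[of x y x' y'] unfolding u a a' b b' c d q_def by (simp add: algebra_simps)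
    then have "u * u' = q" using s(1) t(1) by simp
    then have "u * u - (c * d) * u + q = 0" unfolding sum[symmetric] by (simp add: algebra_simps)
    moreover have "c * d \<in> R" "q \<in> R"
      unfolding q_def using a a' b b' c d four_mem_R by (simp_all add: R_mult R_add R_diff)
    ultimately have "u \<in> R" using monic_quadratic_mem_R by blast
    then show "B (x * y) (x' * y') \<in> ?A" unfolding u by blast
  qed
  \<comment> \<open>For the reverse inclusion the span is taken in one factor at a time, starting
    from \<open>N (x * y) = N x * N y\<close>.\<close>
  have "norm_ideal I \<subseteq> {a. t * a \<in> norm_ideal (prod_ideal I J)}"
  proof (rule norm_ideal_least[OF kmod_preimage[OF kmod_norm_ideal]], rule CollectI)
    fix x assume "x \<in> I"
    have "norm_ideal J \<subseteq> {b. N x * b \<in> norm_ideal (prod_ideal I J)}"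
    proof (rule norm_ideal_least[OF kmod_preimage[OF kmod_norm_ideal]], rule CollectI)
      fix y assume "y \<in> J"
      then have "N (x * y) \<in> norm_ideal (prod_ideal I J)"
        using \<open>x \<in> I\<close> by (intro N_mem_norm_ideal mem_prod_ideal)
      then show "N x * N y \<in> norm_ideal (prod_ideal I J)" by (simp add: N_mult)
    qed
    moreover have "t \<in> norm_ideal J" unfolding t using R_1 by force
    ultimately have "N x * t \<in> norm_ideal (prod_ideal I J)" by blast
    then show "t * N x \<in> norm_ideal (prod_ideal I J)" by (simp add: mult.commute)
  qed
  moreover have "s \<in> norm_ideal I" unfolding s using R_1 by force
  ultimately have "t * s \<in> norm_ideal (prod_ideal I J)" by blast
  then have "r * (t * s) \<in> norm_ideal (prod_ideal I J)" if "r \<in> R" for r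
    using rmodD(3)[OF kmod_norm_ideal that] by blast
  then show "?A \<subseteq> norm_ideal (prod_ideal I J)" by (auto simp: mult.commute mult.left_commute)
qed

text \<open>Some nonzero \<open>d\<close> moves \<open>I\<close> into \<open>S\<close>, so
  \<open>d * d\<close> moves its norms into \<open>R\<close>. Noetherianity gives generators of the
  resulting ideal, and dividing them by \<open>d * d\<close> gives generators of the norm
  ideal.\<close>

lemma frac_ideal_norm_ideal:
  assumes I: "frac_ideal_S R emb S I"
  shows "frac_ideal_R R (norm_ideal I)"
  unfolding frac_ideal_R_def
proof
  have lat: "lattice R emb I" using I by (simp add: frac_ideal_S_def)
  have "\<exists>d\<in>R. d \<noteq> 0 \<and> emb d * x \<in> S" for x using lattice_S unfolding lattice_def by blast
  then obtain d where d: "d \<in> R" "d \<noteq> 0" "\<And>x. x \<in> I \<Longrightarrow> emb d * x \<in> S"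
    using lattice_scale_into[OF lat rmod_lattice[OF lattice_S]] by blast
  let ?Q = "(\<lambda>r. d * d * r) ` norm_ideal I"
  have "norm_ideal I \<subseteq> {r. d * d * r \<in> R}"
  proof (rule norm_ideal_least[OF kmod_preimage[OF kmod_R]])
    fix x assume "x \<in> I"
    then have "N (emb d * x) \<in> R" using d(3) N_mem_R by blast
    then show "N x \<in> {r. d * d * r \<in> R}" by (simp add: N_mult N_emb)
  qed
  then have "r_ideal R ?Q" unfolding r_ideal_iff using kmod_image[OF kmod_norm_ideal] by blast
  moreover have "r_noetherian R" using dedekind by (simp add: dedekind_domain_def)
  ultimately obtain F where F: "finite F" "?Q = rspan R F"
    unfolding r_noetherian_def by (elim allE[of _ ?Q] impE exE conjE)
  let ?c = "inverse (d * d)"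
  let ?G = "(\<lambda>r. ?c * r) ` F"
  have G: "kmod (rspan R ?G)" "?G \<subseteq> rspan R ?G"
    unfolding rspan_eq_rspanL by (rule rmod_rspanL[OF rsub kalg_id], rule rspanL_superset[OF rsub kalg_id])
  have "rspan R F \<subseteq> {r. ?c * r \<in> rspan R ?G}"
    unfolding rspan_eq_rspanL[of R F] by (rule rspanL_least[OF kmod_preimage[OF G(1)]]) (use G(2) in blast)
  then have "?c * (d * d * r) \<in> rspan R ?G" if "r \<in> norm_ideal I" for r
    using that unfolding F(2)[symmetric] by blast
  moreover have "?c * (d * d * r) = r" for r using d(2) by (simp add: field_simps)
  ultimately have 1: "norm_ideal I \<subseteq> rspan R ?G" by (intro subsetI) (simp only:)
  have 2: "rspan R ?G \<subseteq> norm_ideal I"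
    unfolding rspan_eq_rspanL
  proof (rule rspanL_least[OF kmod_norm_ideal], rule subsetI)
    fix g assume "g \<in> ?G"
    then obtain f where f: "f \<in> F" "g = ?c * f" by blast
    have "f \<in> ?Q" unfolding F(2) rspan_eq_rspanL
      using f(1) rspanL_superset[OF rsub kalg_id, of F] by blast
    then obtain r where r: "r \<in> norm_ideal I" "f = d * d * r" by blast
    have "g = r" unfolding f r using d(2) by (simp add: field_simps)
    then show "g \<in> norm_ideal I" using r by simp
  qed
  show "\<exists>F. finite F \<and> norm_ideal I = rspan R F"
    using F(1) 1 2 by (intro exI[of _ ?G]) auto
  \<comment> \<open>A nonzero scalar in \<open>I\<close> has the nonzero norm
    \<open>c * c\<close>.\<close>
  obtain c where c: "c \<noteq> 0" "emb c * 1 \<in> I" using lat unfolding lattice_def by blast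
  then have "c * c \<in> norm_ideal I" using N_mem_norm_ideal[of "emb c"] by (simp add: N_emb)
  moreover have "c * c \<noteq> 0" using c(1) by simp
  ultimately show "norm_ideal I \<noteq> {0}" by (metis singletonD)
qed

section \<open>Local principality and the module index\<close>

lemma prime_kmod: "r_prime_ideal R P \<Longrightarrow> kmod P"
  by (simp add: r_prime_ideal_def r_ideal_iff)

lemma prime_subset: "r_prime_ideal R P \<Longrightarrow> P \<subseteq> R"
  by (simp add: r_prime_ideal_def r_ideal_def)

lemma one_notin_prime: "r_prime_ideal R P \<Longrightarrow> 1 \<notin> P"
  unfolding r_prime_ideal_def r_ideal_def by force

lemma notin_prime_mult:
  "r_prime_ideal R P \<Longrightarrow> a \<in> R - P \<Longrightarrow> b \<in> R - P \<Longrightarrow> a * b \<in> R - P"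
  unfolding r_prime_ideal_def using R_mult by blast

lemma notin_prime_nonzero: "r_prime_ideal R P \<Longrightarrow> a \<in> R - P \<Longrightarrow> a \<noteq> 0"
  using rmodD(1)[OF prime_kmod] by auto

text \<open>Otherwise all products of norms lie in \<open>P\<close>. Polarising in one factor puts
  the mixed products of \<open>B\<close> and \<open>N\<close> into \<open>P\<close>, and then the
  sum and the product of the two \<open>B\<close>-values on products lie in \<open>P\<close>.
  Primality forces the values themselves into \<open>P\<close>, so the norm of every element of
  \<open>S\<close>, even that of 1, would lie in \<open>P\<close>.\<close>

lemma exists_unit_norm_locally:
  assumes P: "r_prime_ideal R P" and I: "rmod R emb I" and J: "rmod R emb J"
    and IJ: "prod_ideal I J = S"
  shows "\<exists>x\<in>I. \<exists>y\<in>J. N x * N y \<in> R - P"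
proof (rule ccontr)
  note PD = rmodD[OF prime_kmod[OF P]] and PR = prime_subset[OF P]
  assume contra: "\<not> ?thesis"
  have S: "x * y \<in> S" if "x \<in> I" "y \<in> J" for x y using mem_prod_ideal[OF that] IJ by simp
  have NN: "N x * N y \<in> P" if "x \<in> I" "y \<in> J" for x y
    using contra N_mem_R[OF S[OF that]] that unfolding N_mult by blast
  have BN: "B x x' * N y \<in> P" if "x \<in> I" "x' \<in> I" "y \<in> J" for x x' y
  proof -
    have "N (x + x') * N y - N x * N y - N x' * N y \<in> P"
      using that rmodD(2)[OF I] by (intro kmod_diff prime_kmod[OF P] NN) auto
    then show ?thesis by (simp add: B_def algebra_simps)
  qed
  have NB: "N x * B y y' \<in> P" if "x \<in> I" "y \<in> J" "y' \<in> J" for x y y'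
  proof -
    have "N x * N (y + y') - N x * N y - N x * N y' \<in> P"
      using that rmodD(2)[OF J] by (intro kmod_diff prime_kmod[OF P] NN) auto
    then show ?thesis by (simp add: B_def algebra_simps)
  qed
  have "N 1 \<in> P"
  proof (rule N_prod_ideal_mem[OF prime_kmod[OF P]])
    show "N (x * y) \<in> P" if "x \<in> I" "y \<in> J" for x y using NN[OF that] by (simp add: N_mult)
    show "1 \<in> prod_ideal I J" by (simp add: IJ)
    fix x y x' y' assume xy: "x \<in> I" "y \<in> J" "x' \<in> I" "y' \<in> J"
    let ?T = "B (x * y) (x' * y')" and ?T' = "B (x * y') (x' * y)"
    have T: "?T \<in> R" "?T' \<in> R" by (rule B_mem_R; rule S; fact xy)+
    have "B x x' * N (y + y') - B x x' * N y - B x x' * N y' \<in> P"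
      using xy rmodD(2)[OF J] by (intro kmod_diff prime_kmod[OF P] BN) auto
    then have sum: "?T + ?T' \<in> P" unfolding B_products_sum by (simp add: B_def[of y y'] algebra_simps)
    have PP: "a * b \<in> P" if "a \<in> P" "b \<in> P" for a b using that PR PD(3) by blast
    \<comment> \<open>The terms of \<open>B_products_mult\<close> are regrouped so that each one is
      a multiple of a product of two elements of \<open>P\<close>.\<close>
    have "(B x x' * N y) * (B x x' * N y') + (N x * B y y') * (N x' * B y y')
        - 4 * ((N x * N y) * (N x' * N y')) \<in> P"
      by (intro kmod_diff prime_kmod[OF P] PD(2) PD(3)[OF four_mem_R]; rule PP)
        (intro BN NB NN xy)+
    also have "(B x x' * N y) * (B x x' * N y') + (N x * B y y') * (N x' * B y y')
        - 4 * ((N x * N y) * (N x' * N y')) = ?T * ?T'"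
      unfolding B_products_mult by (simp add: algebra_simps)
    \<comment> \<open>The difference is the square of \<open>?T\<close>.\<close>
    finally have "?T * (?T + ?T') - ?T * ?T' \<in> P"
      by (rule kmod_diff[OF prime_kmod[OF P] PD(3)[OF T(1) sum]])
    then have "?T * ?T \<in> P" by (simp add: algebra_simps)
    then show "?T \<in> P" using P T unfolding r_prime_ideal_def by blast
  qed
  then show False using one_notin_prime[OF P] by simp
qed

section \<open>Local rings and determinants at a prime\<close>

lemma RlocI: "a \<in> R \<Longrightarrow> b \<in> R - P \<Longrightarrow> a / b \<in> Rloc R P"
  unfolding Rloc_def by blast

lemma Rloc_mult:
  assumes "r_prime_ideal R P" "x \<in> Rloc R P" "y \<in> Rloc R P"
  shows "x * y \<in> Rloc R P"
proof -
  obtain a b c d where "a \<in> R" "b \<in> R - P" "c \<in> R" "d \<in> R - P" "x = a / b" "y = c / d"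
    using assms(2,3) unfolding Rloc_def by blast
  then show ?thesis using RlocI[of "a * c" "b * d"] R_mult notin_prime_mult[OF assms(1)] by simp
qed

lemma mem_locL: "r_prime_ideal R P \<Longrightarrow> m \<in> M \<Longrightarrow> m \<in> locL R emb P M"
  unfolding locL_def
  by (rule CollectI, rule exI[of _ m], rule exI[of _ 1]) (simp add: one_notin_prime)

lemma locL_denominator:
  assumes "r_prime_ideal R P" "z \<in> locL R emb P M"
  obtains b m where "b \<in> R - P" "m \<in> M" "z = emb (inverse b) * m" "emb b * z = m"
proof -
  obtain m b where *: "z = emb (inverse b) * m" "m \<in> M" "b \<in> R - P"
    using assms(2) unfolding locL_def by blast
  then have "b \<noteq> 0" using notin_prime_nonzero[OF assms(1)] by blast
  then have "emb b * z = m" by (simp add: * emb_inverse flip: mult.assoc)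
  with * show thesis using that by blast
qed

text \<open>A common denominator \<open>b\<close> outside \<open>P\<close> turns
  \<open>\<psi>\<close> into an endomorphism of \<open>S\<close>, whose determinant is
  \<open>b * b\<close> times that of \<open>\<psi>\<close> and lies in \<open>R\<close>.\<close>

lemma det_locally_integral:
  assumes P: "r_prime_ideal R P" and \<psi>: "klinear emb \<psi>"
    and S: "\<And>s. s \<in> S \<Longrightarrow> \<exists>b\<in>R - P. emb b * \<psi> s \<in> S"
  shows "detL emb \<psi> \<in> Rloc R P"
proof -
  obtain F where F: "finite F" "S = lspan F" using lattice_S unfolding lattice_def by blast
  have "F \<subseteq> S" using F(2) lspan_superset by simp
  have "\<exists>b\<in>R - P. \<forall>x\<in>lspan F. emb b * \<psi> x \<in> S"
    using one_notin_prime[OF P] S \<open>F \<subseteq> S\<close>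
    by (intro common_denominator notin_prime_mult[OF P] rmod_lattice[OF lattice_S] F(1) \<psi>) auto
  then obtain b where b: "b \<in> R - P" "\<forall>x\<in>S. emb b * \<psi> x \<in> S" using F(2) by blast
  have "detL emb (\<lambda>x. emb b * \<psi> x) \<in> R"
    using b(2) by (intro detL_mem_R klinear_comp[OF klinear_mult \<psi>]) blast
  then have "b * b * detL emb \<psi> \<in> R"
    by (simp add: detL_comp[OF klinear_mult \<psi>] N_emb flip: normL_def)
  then have "(b * b * detL emb \<psi>) / (b * b) \<in> Rloc R P"
    by (rule RlocI) (rule notin_prime_mult[OF P b(1) b(1)])
  then show ?thesis using notin_prime_nonzero[OF P b(1)] by simp
qed

text \<open>Preimages of the basis vectors show that the determinant is nonzero. A vector killed by
  \<open>\<phi>\<close> then pairs to 0 with every vector, so both its coordinates vanish.\<close>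

lemma klinear_inverse:
  assumes \<phi>: "klinear emb \<phi>" and surj: "surj \<phi>"
  obtains \<chi> where "klinear emb \<chi>" "\<And>x. \<chi> (\<phi> x) = x" "detL emb \<phi> * detL emb \<chi> = 1"
proof -
  obtain u v where "\<phi> u = e1" "\<phi> v = e2" using surj by (metis surjD)
  then have "detL emb \<phi> * detpair emb u v = 1"
    using detpair_klinear[OF \<phi>, of u v] by (simp add: detpair_def)
  then have det: "detL emb \<phi> \<noteq> 0" by auto
  have zero: "c = 0" if "\<phi> c = 0" for c
  proof -
    have "detpair emb c w = 0" for w
      using detpair_klinear[OF \<phi>, of c w] that det by (simp add: detpair_def)
    from this[of e1] this[of e2] show ?thesis
      using coord_expand[of c] by (simp add: detpair_def)
  qed
  have diff: "\<phi> (x - y) = \<phi> x - \<phi> y" for x y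
    using klinear_add[OF \<phi>, of "x - y" y] by simp
  have inj: "\<phi> x = \<phi> y \<Longrightarrow> x = y" for x y
    using zero[of "x - y"] by (simp add: diff)
  define \<chi> where "\<chi> = inv_into UNIV \<phi>"
  have \<phi>\<chi>: "\<phi> (\<chi> x) = x" for x unfolding \<chi>_def by (rule surj_f_inv_f[OF surj])
  have \<chi>: "klinear emb \<chi>"
    unfolding klinear_def
    by (intro allI, rule inj) (simp add: \<phi>\<chi> klinear_add[OF \<phi>] klinear_scale[OF \<phi>])
  have "detL emb \<phi> * detL emb \<chi> = 1"
    using detL_comp[OF \<phi> \<chi>] by (simp add: \<phi>\<chi> detL_id)
  moreover have "\<chi> (\<phi> x) = x" for x by (rule inj) (rule \<phi>\<chi>)
  ultimately show thesis using that \<chi> by blast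
qed

section \<open>Ideals with a local generator at a prime\<close>

context
  fixes P I J x y
  assumes P: "r_prime_ideal R P" and I: "frac_ideal_S R emb S I" and IJ: "prod_ideal I J = S"
    and x: "x \<in> I" and y: "y \<in> J" and unit: "N x * N y \<in> R - P"
begin

lemma mult_y_mem_S: "z \<in> I \<Longrightarrow> z * y \<in> S"
  using mem_prod_ideal[of z I y J] y IJ by simp

text \<open>For \<open>z\<close> in \<open>I\<close>, multiplying \<open>N z\<close> by
  \<open>N x * N y\<close>, a unit at \<open>P\<close>, gives \<open>N x * N (z * y)\<close>, where
  \<open>z * y\<close> lies in \<open>S\<close> and so has norm in \<open>R\<close>.\<close>

lemma locK_norm_ideal: "locK R P (norm_ideal I) = (\<lambda>r. N x * r) ` Rloc R P"
proof
  let ?u = "N x * N y"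
  have u0: "?u \<noteq> 0" by (rule notin_prime_nonzero[OF P unit])
  have "norm_ideal I \<subseteq> {j. ?u * j \<in> (\<lambda>r. N x * r) ` R}"
  proof (rule norm_ideal_least[OF kmod_preimage[OF kmod_image[OF kmod_R]]], rule CollectI)
    fix z assume "z \<in> I"
    then have "N (z * y) \<in> R" by (intro N_mem_R mult_y_mem_S)
    moreover have "?u * N z = N x * N (z * y)" by (simp add: N_mult algebra_simps)
    ultimately show "?u * N z \<in> (\<lambda>r. N x * r) ` R" by blast
  qed
  show "locK R P (norm_ideal I) \<subseteq> (\<lambda>r. N x * r) ` Rloc R P"
  proof
    fix k assume "k \<in> locK R P (norm_ideal I)"
    then obtain j b where k: "k = j / b" "j \<in> norm_ideal I" "b \<in> R - P"
      unfolding locK_def by blast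
    then obtain r where r: "r \<in> R" "?u * j = N x * r"
      using \<open>norm_ideal I \<subseteq> _\<close> by blast
    have "b \<noteq> 0" using notin_prime_nonzero[OF P k(3)] .
    have "k = (?u * j) / (?u * b)" unfolding k(1) using u0 by simp
    also have "\<dots> = N x * (r / (?u * b))" unfolding r(2) by simp
    finally show "k \<in> (\<lambda>r. N x * r) ` Rloc R P"
      using RlocI[OF r(1) notin_prime_mult[OF P unit k(3)]] by blast
  qed
  show "(\<lambda>r. N x * r) ` Rloc R P \<subseteq> locK R P (norm_ideal I)"
  proof
    fix k assume "k \<in> (\<lambda>r. N x * r) ` Rloc R P"
    then obtain a b where "k = N x * (a / b)" and ab: "a \<in> R" "b \<in> R" "b \<notin> P"
      unfolding Rloc_def by blast
    then have "k = (a * N x) / b" by simp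
    moreover have "a * N x \<in> norm_ideal I"
      using rmodD(3)[OF kmod_norm_ideal ab(1) N_mem_norm_ideal[OF x]] .
    ultimately show "k \<in> locK R P (norm_ideal I)" unfolding locK_def using ab by blast
  qed
qed

text \<open>The element \<open>x\<close> generates \<open>I\<close> at \<open>P\<close>: up to the
  local unit \<open>N x * N y\<close>, an element \<open>m\<close> of \<open>I\<close> is
  \<open>x\<close> times \<open>(m * y) * cj (x * y)\<close>, and the latter lies in
  \<open>S\<close>.\<close>

lemma mult_x_locL: "(\<lambda>s. x * s) ` locL R emb P S = locL R emb P I"
proof
  show "(\<lambda>s. x * s) ` locL R emb P S \<subseteq> locL R emb P I"
  proof
    fix z assume "z \<in> (\<lambda>s. x * s) ` locL R emb P S"
    then obtain m b where "m \<in> S" and b: "b \<in> R" "b \<notin> P" and "z = x * (emb (inverse b) * m)"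
      unfolding locL_def by blast
    then have "z = emb (inverse b) * (m * x)" "m * x \<in> I"
      using I x by (simp_all add: algebra_simps frac_ideal_S_def)
    then show "z \<in> locL R emb P I" unfolding locL_def using b by blast
  qed
  show "locL R emb P I \<subseteq> (\<lambda>s. x * s) ` locL R emb P S"
  proof
    fix z assume "z \<in> locL R emb P I"
    then obtain m b where m: "m \<in> I" and b: "b \<in> R - P" and z: "z = emb (inverse b) * m"
      unfolding locL_def by blast
    let ?u = "N x * N y"
    have u0: "?u \<noteq> 0" by (rule notin_prime_nonzero[OF P unit])
    let ?s = "emb (inverse (b * ?u)) * ((m * y) * cj (x * y))"
    have "(m * y) * cj (x * y) \<in> S" using m x by (intro S_mult cj_mem_S mult_y_mem_S)
    then have "?s \<in> locL R emb P S"
      unfolding locL_def using notin_prime_mult[OF P b unit] by blast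
    moreover have "x * ?s = z"
    proof -
      have "x * ?s = emb (inverse (b * ?u)) * (m * ((x * y) * cj (x * y)))"
        by (simp only: mult.assoc mult.commute mult.left_commute)
      also have "\<dots> = emb (inverse (b * ?u) * ?u) * m"
        by (simp only: mult_cj N_mult emb_mult mult.assoc mult.commute mult.left_commute)
      also have "inverse (b * ?u) * ?u = inverse b" using u0 by (simp add: field_simps)
      finally show ?thesis using z by simp
    qed
    ultimately show "z \<in> (\<lambda>s. x * s) ` locL R emb P S" by blast
  qed
qed

text \<open>Both \<open>\<phi>\<close> and multiplication by \<open>x\<close> carry \<open>S\<close>
  onto \<open>I\<close> locally. Comparing them in both directions gives local endomorphisms of
  \<open>S\<close>, so their determinants differ by a unit of the local ring.\<close>

lemma detL_locL:
  assumes \<phi>: "klinear emb \<phi>" and im: "\<phi> ` locL R emb P S = locL R emb P I"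
  shows "(\<lambda>r. detL emb \<phi> * r) ` Rloc R P = (\<lambda>r. N x * r) ` Rloc R P"
proof -
  \<comment> \<open>Since \<open>x * ?v = emb ?u\<close>, multiplication by \<open>?v\<close>
    inverts multiplication by \<open>x\<close> up to the local unit \<open>?u\<close>.\<close>
  let ?u = "N x * N y" and ?v = "y * cj (x * y)"
  have u0: "?u \<noteq> 0" by (rule notin_prime_nonzero[OF P unit])
  have "detL emb (\<lambda>s. ?v * \<phi> s) \<in> Rloc R P"
  proof (rule det_locally_integral[OF P klinear_comp[OF klinear_mult \<phi>]])
    fix s assume "s \<in> S"
    then have "\<phi> s \<in> locL R emb P I" using mem_locL[OF P] im by blast
    then obtain b m where b: "b \<in> R - P" "m \<in> I" "emb b * \<phi> s = m" using locL_denominator[OF P] by blast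
    have "emb b * (?v * \<phi> s) = (m * y) * cj (x * y)" unfolding b(3)[symmetric] by (simp add: algebra_simps)
    moreover have "(m * y) * cj (x * y) \<in> S" using b(2) x by (intro S_mult cj_mem_S mult_y_mem_S)
    ultimately show "\<exists>b\<in>R - P. emb b * (?v * \<phi> s) \<in> S" by (intro bexI[OF _ b(1)]) simp
  qed
  moreover have "detL emb (\<lambda>s. ?v * \<phi> s) = N ?v * detL emb \<phi>"
    unfolding normL_def by (rule detL_comp[OF klinear_mult \<phi>])
  moreover have "N ?v = N y * ?u"
    by (simp add: N_mult N_cj)
  ultimately have 1: "N y * ?u * detL emb \<phi> \<in> Rloc R P" by simp
  have "1 / (?u * ?u) \<in> Rloc R P" by (intro RlocI notin_prime_mult[OF P] unit) simp
  from Rloc_mult[OF P 1 this] have \<rho>: "N y * ?u * detL emb \<phi> * (1 / (?u * ?u)) \<in> Rloc R P" (is "?\<rho> \<in> _") .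
  have d1: "detL emb \<phi> = N x * ?\<rho>" using u0 by (simp add: field_simps)
  \<comment> \<open>The image contains \<open>I\<close>, which meets every line of the algebra after
    scaling; linearity then removes the scalar.\<close>
  have "surj \<phi>"
    unfolding surj_def
  proof (rule allI)
    fix z
    obtain d where d: "d \<noteq> 0" "emb d * z \<in> I" using I unfolding frac_ideal_S_def lattice_def by blast
    then obtain s where "emb d * z = \<phi> s" using mem_locL[OF P] im by blast
    then have "\<phi> (emb (inverse d) * s) = emb (inverse d) * (emb d * z)" by (simp add: klinear_scale[OF \<phi>])
    also have "\<dots> = z" using d(1) by (simp flip: mult.assoc emb_mult)
    finally show "\<exists>s. z = \<phi> s" by metis
  qed
  with \<phi> obtain \<chi> where \<chi>: "klinear emb \<chi>" "\<And>x. \<chi> (\<phi> x) = x" "detL emb \<phi> * detL emb \<chi> = 1"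
    using klinear_inverse by blast
  \<comment> \<open>The opposite comparison: multiply by \<open>x\<close>, then undo
    \<open>\<phi>\<close>.\<close>
  have "detL emb (\<lambda>s. \<chi> (x * s)) \<in> Rloc R P"
  proof (rule det_locally_integral[OF P klinear_comp[OF \<chi>(1) klinear_mult]])
    fix s assume "s \<in> S"
    then have "x * s \<in> \<phi> ` locL R emb P S" using mult_x_locL im mem_locL[OF P] by blast
    then obtain t where t: "t \<in> locL R emb P S" "x * s = \<phi> t" by blast
    then obtain b m where b: "b \<in> R - P" "m \<in> S" "emb b * t = m" using locL_denominator[OF P] by blast
    then show "\<exists>b\<in>R - P. emb b * \<chi> (x * s) \<in> S" unfolding t(2) \<chi>(2) by auto
  qed
  moreover have "detL emb (\<lambda>s. \<chi> (x * s)) = detL emb \<chi> * N x"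
    unfolding normL_def by (rule detL_comp[OF \<chi>(1) klinear_mult])
  ultimately have \<sigma>: "detL emb \<chi> * N x \<in> Rloc R P" (is "?\<sigma> \<in> _") by simp
  have d2: "N x = detL emb \<phi> * ?\<sigma>" using \<chi>(3) by (simp flip: mult.assoc)
  show ?thesis
  proof (intro equalityI subsetI)
    fix k assume "k \<in> (\<lambda>r. detL emb \<phi> * r) ` Rloc R P"
    then obtain r where "r \<in> Rloc R P" "k = detL emb \<phi> * r" by blast
    moreover have "detL emb \<phi> * r = N x * (?\<rho> * r)" by (subst d1) (simp only: mult.assoc)
    ultimately show "k \<in> (\<lambda>r. N x * r) ` Rloc R P" using Rloc_mult[OF P \<rho>] by blast
  next
    fix k assume "k \<in> (\<lambda>r. N x * r) ` Rloc R P"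
    then obtain r where "r \<in> Rloc R P" "k = N x * r" by blast
    moreover have "N x * r = detL emb \<phi> * (?\<sigma> * r)" by (subst d2) (simp only: mult.assoc)
    ultimately show "k \<in> (\<lambda>r. detL emb \<phi> * r) ` Rloc R P" using Rloc_mult[OF P \<sigma>] by blast
  qed
qed

end

text \<open>The local computations show that the norm ideal meets the defining condition. For
  uniqueness, any other candidate has the same localization at every prime, and a module is
  recovered from its localizations.\<close>

lemma mindex_eq_norm_ideal:
  assumes "inv_ideal I"
  shows "mindex R emb S I = norm_ideal I"
proof -
  have I: "frac_ideal_S R emb S I" using assms by (rule inv_ideal_frac)
  obtain J where J: "frac_ideal_S R emb S J" "prod_ideal I J = S"
    using assms unfolding invertible_S_def by blast
  show ?thesis
    unfolding mindex_def
  proof (rule the_equality, intro conjI allI impI)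
    show "frac_ideal_R R (norm_ideal I)" by (rule frac_ideal_norm_ideal[OF I])
    fix P \<phi> assume P: "r_prime_ideal R P" and \<phi>: "klinear emb \<phi> \<and> \<phi> ` locL R emb P S = locL R emb P I"
    obtain x y where "x \<in> I" "y \<in> J" "N x * N y \<in> R - P"
      using exists_unit_norm_locally[OF P frac_ideal_rmod[OF I] frac_ideal_rmod[OF J(1)] J(2)] by blast
    note xy = P I J(2) this
    show "locK R P (norm_ideal I) = (\<lambda>x. detL emb \<phi> * x) ` Rloc R P"
      using locK_norm_ideal[OF xy] detL_locL[OF xy] \<phi> by simp
  next
    fix A
    assume A: "frac_ideal_R R A \<and> (\<forall>P. r_prime_ideal R P \<longrightarrow>
        (\<forall>\<phi>. klinear emb \<phi> \<and> \<phi> ` locL R emb P S = locL R emb P I \<longrightarrow>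
              locK R P A = (\<lambda>x. detL emb \<phi> * x) ` Rloc R P))"
    have "kmod A" using A rmod_rspanL[OF rsub kalg_id] unfolding frac_ideal_R_def rspan_eq_rspanL by auto
    have loc: "locK R P A = locK R P (norm_ideal I)" if P: "r_prime_ideal R P" for P
    proof -
      obtain x y where "x \<in> I" "y \<in> J" "N x * N y \<in> R - P"
        using exists_unit_norm_locally[OF P frac_ideal_rmod[OF I] frac_ideal_rmod[OF J(1)] J(2)] by blast
      note xy = P I J(2) this
      \<comment> \<open>The condition on \<open>A\<close> only speaks about suitable maps that
        exist; multiplication by a local generator supplies one at each prime.\<close>
      have "locK R P A = (\<lambda>r. detL emb (\<lambda>s. x * s) * r) ` Rloc R P"
        using A P klinear_mult mult_x_locL[OF xy] by blast
      then show ?thesis using locK_norm_ideal[OF xy] by (simp only: normL_def)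
    qed
    have sub: "C \<subseteq> D" if D: "kmod D" and CD: "\<And>P. r_prime_ideal R P \<Longrightarrow> locK R P C = locK R P D" for C D
    proof
      fix c assume "c \<in> C"
      show "c \<in> D"
      proof (rule mem_if_locally_mem[OF rsub D])
        fix P assume P: "r_prime_ideal R P"
        have "c / 1 \<in> locK R P C" unfolding locK_def using \<open>c \<in> C\<close> one_notin_prime[OF P] R_1 by blast
        then have "c \<in> locK R P D" by (simp add: CD[OF P])
        then obtain d b where "d \<in> D" "b \<in> R - P" "c = d / b" unfolding locK_def by blast
        moreover then have "b * c = d" using notin_prime_nonzero[OF P] by auto
        ultimately show "\<exists>b\<in>R - P. b * c \<in> D" by metis
      qed
    qed
    show "A = norm_ideal I"
      using sub[OF kmod_norm_ideal loc] sub[OF \<open>kmod A\<close> loc[symmetric]] by (rule equalityI)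
  qed
qed

section \<open>Ideal classes and balanced quadruples\<close>

abbreviation "Cl \<equiv> clS R emb S"
abbreviation "cube I \<equiv> prod_ideal I (prod_ideal I I)"

lemma Lunit_1: "Lunit 1"
  unfolding Lunit_def by (intro exI[of _ 1]) simp

lemma Lunit_mult: "Lunit (\<kappa> :: 'l) \<Longrightarrow> Lunit \<mu> \<Longrightarrow> Lunit (\<kappa> * \<mu>)"
  by (simp add: Lunit_iff N_mult)

lemma Lunit_power: "Lunit (\<kappa> :: 'l) \<Longrightarrow> Lunit (\<kappa> ^ n)"
  by (simp add: Lunit_iff N_power)

lemma obtain_inverse:
  assumes "Lunit \<kappa>"
  obtains \<mu> where "Lunit \<mu>" "\<kappa> * \<mu> = 1" "\<mu> * \<kappa> = 1" "N \<kappa> * N \<mu> = 1"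
proof -
  obtain \<mu> where "\<kappa> * \<mu> = 1" using assms unfolding Lunit_def by blast
  moreover then have "\<mu> * \<kappa> = 1" by (simp add: mult.commute)
  moreover have "N \<kappa> * N \<mu> = 1" using calculation by (simp flip: N_mult)
  ultimately show thesis using that unfolding Lunit_def by blast
qed

section \<open>Ideal classes and the 3-torsion group\<close>

lemma mem_clS_iff: "J \<in> Cl I \<longleftrightarrow> inv_ideal J \<and> (\<exists>\<kappa>. Lunit \<kappa> \<and> J = scale \<kappa> I)"
  by (simp add: clS_def)

lemma clS_self: "inv_ideal I \<Longrightarrow> I \<in> Cl I"
  unfolding mem_clS_iff using Lunit_1 scale_1[of I] by metis

lemma clS_scale:
  assumes "Lunit \<kappa>" shows "Cl (scale \<kappa> I) = Cl I"
proof -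
  obtain \<mu> where \<mu>: "Lunit \<mu>" "\<kappa> * \<mu> = 1" "\<mu> * \<kappa> = 1" using assms by (rule obtain_inverse)
  have "(\<exists>\<nu>. Lunit \<nu> \<and> J = scale \<nu> (scale \<kappa> I)) \<longleftrightarrow> (\<exists>\<nu>. Lunit \<nu> \<and> J = scale \<nu> I)" for J
  proof
    assume "\<exists>\<nu>. Lunit \<nu> \<and> J = scale \<nu> (scale \<kappa> I)"
    then show "\<exists>\<nu>. Lunit \<nu> \<and> J = scale \<nu> I"
      unfolding scale_scale using Lunit_mult[OF _ assms] by blast
  next
    assume "\<exists>\<nu>. Lunit \<nu> \<and> J = scale \<nu> I"
    then obtain \<nu> where \<nu>: "Lunit \<nu>" "J = scale \<nu> I" by blast
    have "\<nu> * \<mu> * \<kappa> = \<nu>" by (simp add: mult.assoc \<mu>)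
    then have "J = scale (\<nu> * \<mu>) (scale \<kappa> I)" by (simp only: \<nu>(2) scale_scale)
    then show "\<exists>\<nu>. Lunit \<nu> \<and> J = scale \<nu> (scale \<kappa> I)" using Lunit_mult[OF \<nu>(1) \<mu>(1)] by blast
  qed
  then show ?thesis unfolding clS_def by simp
qed

lemma clS_eq_S_iff:
  assumes "inv_ideal I" shows "Cl I = Cl S \<longleftrightarrow> (\<exists>\<kappa>. Lunit \<kappa> \<and> I = scale \<kappa> S)"
proof
  assume "Cl I = Cl S"
  then show "\<exists>\<kappa>. Lunit \<kappa> \<and> I = scale \<kappa> S" using clS_self[OF assms] mem_clS_iff by blast
qed (use clS_scale in blast)

text \<open>The product of classes is defined through chosen representatives; knowing that the
  choice is a unit multiple of \<open>I\<close> makes the product computable.\<close>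

lemma clS_some:
  assumes "inv_ideal I" obtains \<kappa> where "Lunit \<kappa>" "(SOME J. J \<in> Cl I) = scale \<kappa> I"
proof -
  have "(SOME J. J \<in> Cl I) \<in> Cl I" by (rule someI, rule clS_self, rule assms)
  then show thesis using that unfolding mem_clS_iff by blast
qed

lemma ClSR_mult:
  assumes "inv_ideal I" "inv_ideal J"
  shows "Cl I \<otimes>\<^bsub>ClSR R emb S\<^esub> Cl J = Cl (prod_ideal I J)"
proof -
  obtain \<kappa> where \<kappa>: "Lunit \<kappa>" "(SOME J. J \<in> Cl I) = scale \<kappa> I" using clS_some[OF assms(1)] .
  obtain \<mu> where \<mu>: "Lunit \<mu>" "(SOME I. I \<in> Cl J) = scale \<mu> J" using clS_some[OF assms(2)] .
  show ?thesis
    by (simp add: ClSR_def \<kappa> \<mu> prod_ideal_scale2 clS_scale Lunit_mult)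
qed

lemma ClSR3_mult:
  assumes "inv_ideal I" "inv_ideal J"
  shows "Cl I \<otimes>\<^bsub>ClSR3 R emb S\<^esub> Cl J = Cl (prod_ideal I J)"
  using ClSR_mult[OF assms] by (simp add: ClSR3_def)

lemma ClSR3_one: "\<one>\<^bsub>ClSR3 R emb S\<^esub> = Cl S"
  by (simp add: ClSR3_def ClSR_def)

lemma inv_ideal_cube: "inv_ideal I \<Longrightarrow> inv_ideal (cube I)"
  by (intro inv_ideal_prod)

text \<open>Describes the carrier of \<open>ClSR3\<close> on the level of ideals, with the module
  index already replaced by the norm ideal.\<close>

definition is_torsion :: "'l set \<Rightarrow> bool" where
  "is_torsion I \<longleftrightarrow> inv_ideal I \<and> r_principal R (norm_ideal I) \<and> Cl (cube I) = Cl S"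

lemma ClSR3_carrier: "carrier (ClSR3 R emb S) = Cl ` Collect is_torsion"
proof -
  have pow: "Cl I [^]\<^bsub>ClSR R emb S\<^esub> (3::nat) = Cl (cube I)" if I: "inv_ideal I" for I
  proof -
    have one: "\<one>\<^bsub>ClSR R emb S\<^esub> = Cl S" by (simp add: ClSR_def)
    \<comment> \<open>The recursive definition of the power is unfolded literally, starting from the
      unit class, because no group structure is available yet.\<close>
    have "Cl I [^]\<^bsub>ClSR R emb S\<^esub> (3::nat) = ((\<one>\<^bsub>ClSR R emb S\<^esub> \<otimes>\<^bsub>ClSR R emb S\<^esub> Cl I) \<otimes>\<^bsub>ClSR R emb S\<^esub> Cl I) \<otimes>\<^bsub>ClSR R emb S\<^esub> Cl I"
      by (simp add: nat_pow_def numeral_3_eq_3)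
    also have "\<dots> = Cl (prod_ideal (prod_ideal I I) I)"
      by (simp add: one ClSR_mult I inv_ideal_S inv_ideal_prod prod_ideal_S inv_ideal_frac)
    also have "prod_ideal (prod_ideal I I) I = cube I" by (rule prod_ideal_assoc)
    finally show ?thesis .
  qed
  have "x \<in> carrier (ClSR3 R emb S) \<longleftrightarrow> (\<exists>I. is_torsion I \<and> x = Cl I)" for x
  proof -
    have "x \<in> carrier (ClSR3 R emb S) \<longleftrightarrow>
      (\<exists>I. x = Cl I \<and> inv_ideal I \<and> r_principal R (mindex R emb S I)) \<and>
      x [^]\<^bsub>ClSR R emb S\<^esub> (3::nat) = \<one>\<^bsub>ClSR R emb S\<^esub>"
      by (simp add: ClSR3_def) (simp add: ClSR_def)
    also have "\<one>\<^bsub>ClSR R emb S\<^esub> = Cl S" by (simp add: ClSR_def)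
    finally show ?thesis
      unfolding is_torsion_def using pow mindex_eq_norm_ideal by (metis (no_types, lifting))
  qed
  then show ?thesis by blast
qed

lemma r_principal_prod:
  assumes "frac_ideal_S R emb S I" "frac_ideal_S R emb S J"
    "r_principal R (norm_ideal I)" "r_principal R (norm_ideal J)"
  shows "r_principal R (norm_ideal (prod_ideal I J))"
proof -
  obtain s where s: "s \<noteq> 0" "norm_ideal I = (\<lambda>r. s * r) ` R" using assms(3) unfolding r_principal_def by blast
  obtain t where t: "t \<noteq> 0" "norm_ideal J = (\<lambda>r. t * r) ` R" using assms(4) unfolding r_principal_def by blast
  have "s * t \<noteq> 0" using s t by simp
  then show ?thesis using norm_ideal_prod[OF assms(1,2) s t] unfolding r_principal_def by blast
qed

lemma cube_prod: "cube (prod_ideal I J) = prod_ideal (cube I) (cube J)"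
  by (simp only: prod_ideal_ac)

lemma cube_scale: "cube (scale \<kappa> I) = scale (\<kappa> ^ 3) (cube I)"
  unfolding prod_ideal_scale2 power3_eq_cube mult.assoc[of \<kappa> \<kappa> \<kappa>] by (rule refl)

lemma cube_S: "cube S = S"
  by (simp add: prod_ideal_S frac_ideal_S_self)

lemma is_torsion_S: "is_torsion S"
proof -
  have "r_principal R (norm_ideal S)"
    unfolding r_principal_def norm_ideal_S by (intro exI[of _ 1]) simp
  then show ?thesis by (simp add: is_torsion_def inv_ideal_S cube_S)
qed

lemma is_torsion_prod:
  assumes "is_torsion I" "is_torsion J" shows "is_torsion (prod_ideal I J)"
proof -
  note * = assms[unfolded is_torsion_def]
  have "Cl (cube (prod_ideal I J)) = Cl (cube I) \<otimes>\<^bsub>ClSR R emb S\<^esub> Cl (cube J)"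
    unfolding cube_prod using * by (intro ClSR_mult[symmetric] inv_ideal_cube) auto
  also have "\<dots> = Cl S \<otimes>\<^bsub>ClSR R emb S\<^esub> Cl S" using * by simp
  also have "\<dots> = Cl S" by (simp add: ClSR_mult inv_ideal_S prod_ideal_S frac_ideal_S_self)
  finally show ?thesis
    using * unfolding is_torsion_def
    by (intro conjI inv_ideal_prod r_principal_prod inv_ideal_frac) blast+
qed

lemma group_ClSR3: "group (ClSR3 R emb S)"
proof (rule groupI)
  let ?G = "ClSR3 R emb S"
  have inv: "is_torsion I \<Longrightarrow> inv_ideal I" for I by (simp add: is_torsion_def)
  show "\<one>\<^bsub>?G\<^esub> \<in> carrier ?G" unfolding ClSR3_one ClSR3_carrier using is_torsion_S by blast
  fix x assume "x \<in> carrier ?G"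
  then obtain I where I: "x = Cl I" "is_torsion I" unfolding ClSR3_carrier by blast
  show "\<one>\<^bsub>?G\<^esub> \<otimes>\<^bsub>?G\<^esub> x = x"
    unfolding ClSR3_one I by (simp add: ClSR3_mult inv I(2) inv_ideal_S prod_ideal_S inv_ideal_frac)
  \<comment> \<open>As the cube of the class is trivial, its square serves as the inverse, and
    membership of the square follows from closure under products.\<close>
  have "Cl (prod_ideal I I) \<otimes>\<^bsub>?G\<^esub> Cl I = Cl (cube I)"
    by (simp add: ClSR3_mult inv_ideal_prod inv I(2) prod_ideal_assoc)
  also have "\<dots> = \<one>\<^bsub>?G\<^esub>" using I(2) by (simp add: is_torsion_def ClSR3_one)
  finally show "\<exists>y\<in>carrier ?G. y \<otimes>\<^bsub>?G\<^esub> x = \<one>\<^bsub>?G\<^esub>"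
    unfolding ClSR3_carrier I(1) using is_torsion_prod[OF I(2) I(2)] by blast
  fix y assume "y \<in> carrier ?G"
  then obtain J where J: "y = Cl J" "is_torsion J" unfolding ClSR3_carrier by blast
  show "x \<otimes>\<^bsub>?G\<^esub> y \<in> carrier ?G"
    unfolding I J using is_torsion_prod[OF I(2) J(2)]
    by (simp add: ClSR3_mult inv I(2) J(2) ClSR3_carrier)
  fix z assume "z \<in> carrier ?G"
  then obtain K where K: "z = Cl K" "is_torsion K" unfolding ClSR3_carrier by blast
  show "x \<otimes>\<^bsub>?G\<^esub> y \<otimes>\<^bsub>?G\<^esub> z = x \<otimes>\<^bsub>?G\<^esub> (y \<otimes>\<^bsub>?G\<^esub> z)"
    unfolding I J K by (simp add: ClSR3_mult inv I(2) J(2) K(2) inv_ideal_prod prod_ideal_assoc)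
qed

section \<open>Balanced triples and their classes\<close>

lemma QB_iff: "(I, \<delta>, s) \<in> QB R emb S \<longleftrightarrow> inv_ideal I \<and> Lunit \<delta> \<and> s \<noteq> 0 \<and>
    cube I \<subseteq> scale \<delta> S \<and> norm_ideal I = (\<lambda>r. s * r) ` R \<and> s ^ 3 = N \<delta>"
  unfolding QB_def balanced_def using mindex_eq_norm_ideal[of I] inv_ideal_frac[of I] by auto

lemma norm_ideal_cube:
  assumes "frac_ideal_S R emb S I" "s \<noteq> 0" "norm_ideal I = (\<lambda>r. s * r) ` R"
  shows "norm_ideal (cube I) = (\<lambda>r. s ^ 3 * r) ` R"
proof -
  have "norm_ideal (prod_ideal I I) = (\<lambda>r. s * s * r) ` R"
    by (rule norm_ideal_prod[OF assms(1,1,2,3,2,3)])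
  from norm_ideal_prod[OF assms(1) frac_ideal_prod[OF assms(1,1)] assms(2,3) _ this]
  show ?thesis using assms(2) by (simp add: power3_eq_cube mult.assoc)
qed

text \<open>Dividing the cube by \<open>\<delta>\<close> gives an ideal inside \<open>S\<close>
  whose norm ideal is generated by \<open>s ^ 3 / N \<delta> = 1\<close>, so this ideal is all of
  \<open>S\<close>.\<close>

lemma QB_cube:
  assumes "(I, \<delta>, s) \<in> QB R emb S" shows "cube I = scale \<delta> S"
proof -
  note q = assms[unfolded QB_iff]
  obtain \<mu> where \<mu>: "Lunit \<mu>" "\<delta> * \<mu> = 1" "\<mu> * \<delta> = 1" "N \<delta> * N \<mu> = 1" using q obtain_inverse by blast
  have I: "frac_ideal_S R emb S I" using q inv_ideal_frac by blast
  have "scale \<mu> (cube I) \<subseteq> scale \<mu> (scale \<delta> S)" using q by (intro image_mono) blast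
  then have sub: "scale \<mu> (cube I) \<subseteq> S" by (simp add: scale_scale \<mu>)
  have "N \<mu> * (s ^ 3 * 1) \<in> norm_ideal (scale \<mu> (cube I))"
    unfolding norm_ideal_scale using norm_ideal_cube[OF I, of s] q R_1 by blast
  moreover have "N \<mu> * (s ^ 3 * 1) = 1" using q \<mu>(4) by (simp add: mult.commute)
  ultimately have "scale \<mu> (cube I) = S"
    using sub I \<mu>(1) by (intro eq_S_if_norm_ideal_eq_R frac_ideal_scale frac_ideal_prod) auto
  then have "scale \<delta> (scale \<mu> (cube I)) = scale \<delta> S" by simp
  then show ?thesis by (simp add: scale_scale \<mu>)
qed

text \<open>The action of units of the algebra on triples, whose orbits are the classes of
  \<open>qequiv\<close>.\<close>

definition act :: "'l \<Rightarrow> 'l set \<times> 'l \<times> 'k \<Rightarrow> 'l set \<times> 'l \<times> 'k" where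
  "act \<kappa> q = (case q of (I, \<delta>, s) \<Rightarrow> (scale \<kappa> I, \<kappa> ^ 3 * \<delta>, N \<kappa> * s))"

lemma act_1: "act 1 q = q"
  by (cases q) (simp add: act_def)

lemma act_act: "act \<kappa> (act \<mu> q) = act (\<kappa> * \<mu>) q"
  by (cases q) (simp add: act_def scale_scale power_mult_distrib N_mult mult.assoc)

lemma qequiv_iff: "qequiv emb q q' \<longleftrightarrow> (\<exists>\<kappa>. Lunit \<kappa> \<and> q' = act \<kappa> q)"
  by (cases q; cases q') (simp add: qequiv_def act_def)

lemma act_QB:
  assumes "q \<in> QB R emb S" "Lunit \<kappa>" shows "act \<kappa> q \<in> QB R emb S"
proof -
  obtain I \<delta> s where q: "q = (I, \<delta>, s)" by (cases q)
  note QB = assms(1)[unfolded q QB_iff]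
  have "cube (scale \<kappa> I) = scale (\<kappa> ^ 3 * \<delta>) S"
    unfolding cube_scale QB_cube[OF assms(1)[unfolded q]] by (rule scale_scale)
  moreover have "norm_ideal (scale \<kappa> I) = (\<lambda>r. N \<kappa> * s * r) ` R"
    unfolding norm_ideal_scale using QB by (simp add: image_image mult.assoc)
  moreover have "(N \<kappa> * s) ^ 3 = N (\<kappa> ^ 3 * \<delta>)"
    using QB by (simp add: power_mult_distrib N_mult N_power)
  ultimately show ?thesis
    unfolding q act_def using QB assms(2)
    by (simp add: QB_iff inv_ideal_scale Lunit_mult Lunit_power) (simp add: Lunit_iff)
qed

lemma qcl_eq_orbit: "q \<in> QB R emb S \<Longrightarrow> qcl R emb S q = {act \<kappa> q | \<kappa>. Lunit \<kappa>}"
  unfolding qcl_def qequiv_iff using act_QB by blast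

lemma qcl_eq_iff:
  assumes q: "q \<in> QB R emb S" and q': "q' \<in> QB R emb S"
  shows "qcl R emb S q = qcl R emb S q' \<longleftrightarrow> (\<exists>\<kappa>. Lunit \<kappa> \<and> q' = act \<kappa> q)"
proof
  assume "qcl R emb S q = qcl R emb S q'"
  moreover have "q' \<in> qcl R emb S q'" unfolding qcl_eq_orbit[OF q'] using act_1[of q'] Lunit_1 by force
  ultimately show "\<exists>\<kappa>. Lunit \<kappa> \<and> q' = act \<kappa> q" unfolding qcl_eq_orbit[OF q] by blast
next
  assume "\<exists>\<kappa>. Lunit \<kappa> \<and> q' = act \<kappa> q"
  then obtain \<kappa> where \<kappa>: "Lunit \<kappa>" "q' = act \<kappa> q" by blast
  obtain \<mu> where \<mu>: "Lunit \<mu>" "\<mu> * \<kappa> = 1" using \<kappa>(1) obtain_inverse by blast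
  have "act \<nu> q' = act (\<nu> * \<kappa>) q" for \<nu> by (simp add: \<kappa>(2) act_act)
  moreover have "act \<nu> q = act (\<nu> * \<mu>) q'" for \<nu> by (simp add: \<kappa>(2) act_act mult.assoc \<mu>(2))
  ultimately show "qcl R emb S q = qcl R emb S q'"
    unfolding qcl_eq_orbit[OF q] qcl_eq_orbit[OF q'] using Lunit_mult \<kappa>(1) \<mu>(1) by blast
qed

lemma qcl_some:
  assumes "q \<in> QB R emb S" obtains \<kappa> where "Lunit \<kappa>" "(SOME a. a \<in> qcl R emb S q) = act \<kappa> q"
proof -
  have "act 1 q \<in> qcl R emb S q" unfolding qcl_eq_orbit[OF assms] using Lunit_1 by blast
  then have "(SOME a. a \<in> qcl R emb S q) \<in> qcl R emb S q" by (rule someI)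
  then show thesis using that unfolding qcl_eq_orbit[OF assms] by blast
qed

text \<open>This is why the product of two orbits does not depend on the chosen
  representatives.\<close>

lemma qmult_act: "qmult R emb (act \<kappa> q) (act \<mu> q') = act (\<kappa> * \<mu>) (qmult R emb q q')"
  by (cases q; cases q')
    (simp only: qmult_def act_def prod.case prod.inject prod_ideal_scale2 power_mult_distrib N_mult,
      intro conjI refl; simp only: mult_ac)

lemma qmult_QB:
  assumes "q \<in> QB R emb S" "q' \<in> QB R emb S" shows "qmult R emb q q' \<in> QB R emb S"
proof -
  obtain I \<delta> s where q: "q = (I, \<delta>, s)" by (cases q)
  obtain I' \<delta>' s' where q': "q' = (I', \<delta>', s')" by (cases q')
  note QB = assms(1)[unfolded q QB_iff] and QB' = assms(2)[unfolded q' QB_iff]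
  have "cube (prod_ideal I I') = scale (\<delta> * \<delta>') S"
    unfolding cube_prod QB_cube[OF assms(1)[unfolded q]] QB_cube[OF assms(2)[unfolded q']]
    by (simp add: prod_ideal_scale2 prod_ideal_S frac_ideal_S_self)
  moreover have "norm_ideal (prod_ideal I I') = (\<lambda>r. s * s' * r) ` R"
    using QB QB' by (intro norm_ideal_prod inv_ideal_frac) auto
  ultimately show ?thesis
    unfolding q q' qmult_def using QB QB'
    by (simp add: QB_iff inv_ideal_prod Lunit_mult power_mult_distrib N_mult)
qed

lemma QG_mult:
  assumes "q \<in> QB R emb S" "q' \<in> QB R emb S"
  shows "qcl R emb S q \<otimes>\<^bsub>QG R emb S\<^esub> qcl R emb S q' = qcl R emb S (qmult R emb q q')"
proof -
  obtain \<kappa> where \<kappa>: "Lunit \<kappa>" "(SOME a. a \<in> qcl R emb S q) = act \<kappa> q" using qcl_some[OF assms(1)] .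
  obtain \<mu> where \<mu>: "Lunit \<mu>" "(SOME a. a \<in> qcl R emb S q') = act \<mu> q'" using qcl_some[OF assms(2)] .
  have "qcl R emb S (act (\<kappa> * \<mu>) (qmult R emb q q')) = qcl R emb S (qmult R emb q q')"
    using qcl_eq_iff[OF qmult_QB[OF assms] act_QB[OF qmult_QB[OF assms]]] Lunit_mult[OF \<kappa>(1) \<mu>(1)] by blast
  then show ?thesis by (simp add: QG_def \<kappa> \<mu> qmult_act)
qed

lemma QG_carrier: "carrier (QG R emb S) = qcl R emb S ` QB R emb S"
  and QG_one: "\<one>\<^bsub>QG R emb S\<^esub> = qcl R emb S (S, 1, 1)"
  by (simp_all add: QG_def)

text \<open>The units of \<open>S\<close> are the stabiliser of \<open>S\<close> under scaling, so
  statements about units can be handled as equalities of ideals.\<close>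

lemma scale_eq_S_iff: "scale \<epsilon> S = S \<longleftrightarrow> \<epsilon> \<in> S \<and> (\<exists>y\<in>S. \<epsilon> * y = 1)"
proof
  assume eq: "scale \<epsilon> S = S"
  have "\<epsilon> * 1 \<in> scale \<epsilon> S" by (rule imageI) simp
  then have "\<epsilon> \<in> S" by (simp only: eq mult_1_right)
  moreover have "1 \<in> scale \<epsilon> S" by (simp only: eq S_1)
  then obtain y where "y \<in> S" "1 = \<epsilon> * y" by blast
  ultimately show "\<epsilon> \<in> S \<and> (\<exists>y\<in>S. \<epsilon> * y = 1)" by metis
next
  assume "\<epsilon> \<in> S \<and> (\<exists>y\<in>S. \<epsilon> * y = 1)"
  then obtain y where y: "\<epsilon> \<in> S" "y \<in> S" "\<epsilon> * y = 1" by blast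
  show "scale \<epsilon> S = S"
  proof
    show "scale \<epsilon> S \<subseteq> S" using S_mult[OF y(1)] by blast
    show "S \<subseteq> scale \<epsilon> S"
    proof
      fix t assume "t \<in> S"
      then have "y * t \<in> S" using S_mult[OF y(2)] by blast
      moreover have "t = \<epsilon> * (y * t)" using y(3) by (simp flip: mult.assoc)
      ultimately show "t \<in> scale \<epsilon> S" by blast
    qed
  qed
qed

text \<open>From right to left, \<open>QB_cube\<close> upgrades the inclusion of \<open>S\<close> in
  \<open>scale \<epsilon> S\<close> to an equality, which makes \<open>\<epsilon>\<close> a unit of
  \<open>S\<close>.\<close>

lemma UN1_iff_QB: "\<epsilon> \<in> carrier (UN1 emb S) \<longleftrightarrow> (S, \<epsilon>, 1) \<in> QB R emb S"
proof -
  have "\<epsilon> \<in> carrier (UN1 emb S) \<longleftrightarrow> scale \<epsilon> S = S \<and> N \<epsilon> = 1"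
    unfolding scale_eq_S_iff by (auto simp: UN1_def)
  also have "\<dots> \<longleftrightarrow> (S, \<epsilon>, 1) \<in> QB R emb S"
  proof
    assume "scale \<epsilon> S = S \<and> N \<epsilon> = 1"
    then show "(S, \<epsilon>, 1) \<in> QB R emb S"
      by (simp add: QB_iff inv_ideal_S cube_S norm_ideal_S Lunit_iff)
  next
    assume q: "(S, \<epsilon>, 1) \<in> QB R emb S"
    then show "scale \<epsilon> S = S \<and> N \<epsilon> = 1" using QB_cube[OF q] unfolding QB_iff cube_S by simp
  qed
  finally show ?thesis .
qed

lemma one_QB: "(S, 1, 1) \<in> QB R emb S"
  by (simp add: QB_iff inv_ideal_S cube_S norm_ideal_S Lunit_1)

text \<open>The cube of \<open>I * I\<close> is \<open>\<delta> * \<delta>\<close> times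
  \<open>S\<close>, and the factor \<open>\<mu> ^ 3\<close> from rescaling leaves exactly
  \<open>\<mu>\<close>.\<close>

lemma inverse_QB:
  assumes q: "(I, \<delta>, s) \<in> QB R emb S" and \<mu>: "\<mu> * \<delta> = 1"
  shows "(scale \<mu> (prod_ideal I I), \<mu>, inverse s) \<in> QB R emb S"
proof -
  note QB = q[unfolded QB_iff]
  have "Lunit \<mu>" using \<mu> unfolding Lunit_def by blast
  have s0: "s \<noteq> 0" using QB by blast
  have I: "frac_ideal_S R emb S I" using QB inv_ideal_frac by blast
  have N\<mu>: "N \<mu> = inverse s ^ 3"
    using N_eq_inverse[of \<delta> \<mu>] \<mu> QB by (simp add: mult.commute power_inverse)
  have "cube (prod_ideal I I) = scale (\<delta> * \<delta>) S"
    unfolding cube_prod QB_cube[OF q] by (simp add: prod_ideal_scale2 prod_ideal_S frac_ideal_S_self)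
  moreover have "\<mu> ^ 3 * (\<delta> * \<delta>) = \<mu> * (\<mu> * \<delta>) * (\<mu> * \<delta>)"
    by (simp add: power3_eq_cube algebra_simps)
  ultimately have "cube (scale \<mu> (prod_ideal I I)) = scale \<mu> S"
    unfolding cube_scale by (simp add: scale_scale \<mu>)
  moreover have "norm_ideal (scale \<mu> (prod_ideal I I)) = (\<lambda>r. inverse s * r) ` R"
  proof -
    have "norm_ideal (prod_ideal I I) = (\<lambda>r. s * s * r) ` R"
      using QB by (intro norm_ideal_prod I) auto
    moreover have "N \<mu> * (s * s * r) = inverse s * r" for r
      unfolding N\<mu> using s0 by (simp add: power3_eq_cube field_simps)
    ultimately show ?thesis unfolding norm_ideal_scale by (simp only: image_image)
  qed
  ultimately show ?thesis
    using QB \<open>Lunit \<mu>\<close> N\<mu> by (simp add: QB_iff inv_ideal_scale inv_ideal_prod)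
qed

lemma group_QG: "group (QG R emb S)"
proof (rule groupI)
  let ?G = "QG R emb S" and ?c = "qcl R emb S"
  show "\<one>\<^bsub>?G\<^esub> \<in> carrier ?G" unfolding QG_one QG_carrier using one_QB by blast
  fix x assume "x \<in> carrier ?G"
  then obtain q where q: "x = ?c q" "q \<in> QB R emb S" unfolding QG_carrier by blast
  obtain I \<delta> s where Is: "q = (I, \<delta>, s)" by (cases q)
  note QB = q(2)[unfolded Is QB_iff]
  have "qmult R emb (S, 1, 1) q = q"
    using QB by (simp add: qmult_def Is prod_ideal_S inv_ideal_frac)
  then show "\<one>\<^bsub>?G\<^esub> \<otimes>\<^bsub>?G\<^esub> x = x" unfolding QG_one q(1) by (simp add: QG_mult one_QB q(2))
  have "Lunit \<delta>" using QB by blast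
  then obtain \<mu> where "Lunit \<mu>" "\<delta> * \<mu> = 1" and \<mu>: "\<mu> * \<delta> = 1" and "N \<delta> * N \<mu> = 1"
    by (rule obtain_inverse)
  let ?q = "(scale \<mu> (prod_ideal I I), \<mu>, inverse s)"
  have q': "?q \<in> QB R emb S" by (rule inverse_QB[OF q(2)[unfolded Is] \<mu>])
  have "qmult R emb ?q q = (S, 1, 1)"
    using QB QB_cube[OF q(2)[unfolded Is]]
    by (simp add: qmult_def Is prod_ideal_scale prod_ideal_assoc scale_scale \<mu>)
  then have "?c ?q \<otimes>\<^bsub>?G\<^esub> x = \<one>\<^bsub>?G\<^esub>" unfolding q(1) QG_one by (simp add: QG_mult q' q(2))
  then show "\<exists>y\<in>carrier ?G. y \<otimes>\<^bsub>?G\<^esub> x = \<one>\<^bsub>?G\<^esub>" unfolding QG_carrier using q' by blast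
  fix y assume "y \<in> carrier ?G"
  then obtain p where p: "y = ?c p" "p \<in> QB R emb S" unfolding QG_carrier by blast
  show "x \<otimes>\<^bsub>?G\<^esub> y \<in> carrier ?G"
    unfolding q(1) p(1) QG_mult[OF q(2) p(2)] QG_carrier by (intro imageI qmult_QB q p)
  fix z assume "z \<in> carrier ?G"
  then obtain r where r: "z = ?c r" "r \<in> QB R emb S" unfolding QG_carrier by blast
  have "qmult R emb (qmult R emb q p) r = qmult R emb q (qmult R emb p r)"
    by (cases q; cases p; cases r) (simp add: qmult_def prod_ideal_assoc mult.assoc)
  then show "x \<otimes>\<^bsub>?G\<^esub> y \<otimes>\<^bsub>?G\<^esub> z = x \<otimes>\<^bsub>?G\<^esub> (y \<otimes>\<^bsub>?G\<^esub> z)"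
    unfolding q(1) p(1) r(1) by (simp add: QG_mult q(2) p(2) r(2) qmult_QB)
qed

section \<open>The map from balanced triples to ideal classes\<close>

definition class_map :: "('l set \<times> 'l \<times> 'k) set \<Rightarrow> 'l set set" where
  "class_map A = Cl (fst (SOME q. q \<in> A))"

text \<open>Another representative of the orbit only rescales the ideal by a unit, which does not
  change its class.\<close>

lemma class_map_qcl:
  assumes "q \<in> QB R emb S" shows "class_map (qcl R emb S q) = Cl (fst q)"
proof -
  obtain \<kappa> where \<kappa>: "Lunit \<kappa>" "(SOME a. a \<in> qcl R emb S q) = act \<kappa> q" using qcl_some[OF assms] .
  have "fst (act \<kappa> q) = scale \<kappa> (fst q)" by (cases q) (simp add: act_def)
  then show ?thesis by (simp add: class_map_def \<kappa> clS_scale)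
qed

lemma QB_is_torsion:
  assumes "q \<in> QB R emb S" shows "is_torsion (fst q)"
proof -
  obtain I \<delta> s where q: "q = (I, \<delta>, s)" by (cases q)
  note QB = assms[unfolded q QB_iff]
  have "Cl (cube I) = Cl S" using QB QB_cube[OF assms[unfolded q]] clS_scale by simp
  then show ?thesis using QB unfolding q is_torsion_def r_principal_def by auto
qed

lemma class_map_hom: "class_map \<in> hom (QG R emb S) (ClSR3 R emb S)"
proof (rule homI)
  fix x assume "x \<in> carrier (QG R emb S)"
  then obtain q where q: "x = qcl R emb S q" "q \<in> QB R emb S" unfolding QG_carrier by blast
  show "class_map x \<in> carrier (ClSR3 R emb S)"
    unfolding q(1) class_map_qcl[OF q(2)] ClSR3_carrier using QB_is_torsion[OF q(2)] by blast
  fix y assume "y \<in> carrier (QG R emb S)"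
  then obtain p where p: "y = qcl R emb S p" "p \<in> QB R emb S" unfolding QG_carrier by blast
  have "fst (qmult R emb q p) = prod_ideal (fst q) (fst p)" by (cases q; cases p) (simp add: qmult_def)
  moreover have "inv_ideal (fst q)" "inv_ideal (fst p)"
    using q(2) p(2) QB_is_torsion is_torsion_def by blast+
  ultimately show "class_map (x \<otimes>\<^bsub>QG R emb S\<^esub> y) = class_map x \<otimes>\<^bsub>ClSR3 R emb S\<^esub> class_map y"
    unfolding q(1) p(1) QG_mult[OF q(2) p(2)] class_map_qcl[OF q(2)] class_map_qcl[OF p(2)]
      class_map_qcl[OF qmult_QB[OF q(2) p(2)]]
    by (simp add: ClSR3_mult)
qed

lemma is_torsion_lift:
  assumes "is_torsion I" shows "\<exists>q\<in>QB R emb S. fst q = I"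
proof -
  have inv: "inv_ideal I" and "r_principal R (norm_ideal I)" and "Cl (cube I) = Cl S"
    using assms by (auto simp: is_torsion_def)
  then obtain s where s: "s \<noteq> 0" "norm_ideal I = (\<lambda>r. s * r) ` R" unfolding r_principal_def by blast
  obtain \<delta> where \<delta>: "Lunit \<delta>" "cube I = scale \<delta> S"
    using clS_eq_S_iff[OF inv_ideal_cube[OF inv]] \<open>Cl (cube I) = Cl S\<close> by blast
  \<comment> \<open>The norm ideal of the cube of \<open>I\<close> computed in two ways: by
    multiplicativity and from the generator \<open>\<delta>\<close>.\<close>
  have "(\<lambda>r. s ^ 3 * r) ` R = (\<lambda>r. N \<delta> * r) ` R"
    using norm_ideal_cube[OF inv_ideal_frac[OF inv] s] unfolding \<delta>(2) norm_ideal_scale norm_ideal_S by simp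
  moreover have "s ^ 3 * 1 \<in> (\<lambda>r. s ^ 3 * r) ` R" "N \<delta> * 1 \<in> (\<lambda>r. N \<delta> * r) ` R" using R_1 by blast+
  ultimately obtain u v where u: "u \<in> R" "s ^ 3 = N \<delta> * u" and v: "v \<in> R" "N \<delta> = s ^ 3 * v"
    by (metis (no_types, lifting) imageE mult_1_right)
  have "N \<delta> * (u * v) = N \<delta> * 1" using u(2) v(2) by (simp flip: mult.assoc)
  then have uv: "u * v = 1" using \<delta>(1) by (simp add: Lunit_iff)
  \<comment> \<open>The pair \<open>(\<delta>, s)\<close> is only balanced up to the unit \<open>u = s\<^sup>3 / N \<delta>\<close> of \<open>R\<close>;
    since \<open>N (u\<^sup>2) = u\<^sup>4 = u\<^sup>3 u\<close>, rescaling to \<open>(u\<^sup>2 \<delta>, u s)\<close> repairs this.\<close>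
  let ?q = "(I, emb (u * u) * \<delta>, u * s)"
  have "?q \<in> QB R emb S" unfolding QB_iff
  proof (intro conjI)
    have u0: "u \<noteq> 0" using uv by auto
    show "inv_ideal I" by (rule inv)
    show "Lunit (emb (u * u) * \<delta>)" using \<delta>(1) u0 by (simp add: Lunit_iff N_mult N_emb)
    show "u * s \<noteq> 0" using u0 s(1) by simp
    show "cube I \<subseteq> scale (emb (u * u) * \<delta>) S" unfolding \<delta>(2)
    proof
      fix z assume "z \<in> scale \<delta> S"
      then obtain t where t: "t \<in> S" "z = \<delta> * t" by blast
      have "emb (u * u) * \<delta> * (emb (v * v) * t) = emb ((u * v) * (u * v)) * (\<delta> * t)"
        by (simp add: emb_mult algebra_simps)
      then have "z = emb (u * u) * \<delta> * (emb (v * v) * t)" by (simp add: uv t(2))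
      moreover have "emb (v * v) * t \<in> S" by (intro S_mod(3) R_mult v(1) t(1))
      ultimately show "z \<in> scale (emb (u * u) * \<delta>) S" by blast
    qed
    show "norm_ideal I = (\<lambda>r. u * s * r) ` R" unfolding s(2)
    proof (intro equalityI subsetI)
      fix z assume "z \<in> (\<lambda>r. s * r) ` R"
      then obtain r where r: "r \<in> R" "z = s * r" by blast
      have "u * s * (v * r) = (u * v) * (s * r)" by (simp add: algebra_simps)
      then have "z = u * s * (v * r)" by (simp add: uv r(2))
      then show "z \<in> (\<lambda>r. u * s * r) ` R" using R_mult[OF v(1) r(1)] by blast
    next
      fix z assume "z \<in> (\<lambda>r. u * s * r) ` R"
      then obtain r where r: "r \<in> R" "z = u * s * r" by blast
      then have "z = s * (u * r)" by (simp add: algebra_simps)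
      then show "z \<in> (\<lambda>r. s * r) ` R" using R_mult[OF u(1) r(1)] by blast
    qed
    show "(u * s) ^ 3 = N (emb (u * u) * \<delta>)"
      unfolding power_mult_distrib u(2) by (simp add: N_mult N_emb power3_eq_cube algebra_simps)
  qed
  then show ?thesis by force
qed

lemma class_map_surj: "class_map ` carrier (QG R emb S) = carrier (ClSR3 R emb S)"
proof
  show "class_map ` carrier (QG R emb S) \<subseteq> carrier (ClSR3 R emb S)"
    using class_map_hom unfolding hom_def by blast
  show "carrier (ClSR3 R emb S) \<subseteq> class_map ` carrier (QG R emb S)"
  proof
    fix A assume "A \<in> carrier (ClSR3 R emb S)"
    then obtain I where I: "is_torsion I" "A = Cl I" unfolding ClSR3_carrier by blast
    obtain q where q: "q \<in> QB R emb S" "fst q = I" using is_torsion_lift[OF I(1)] by blast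
    have "A = class_map (qcl R emb S q)" by (simp add: class_map_qcl q I(2))
    then show "A \<in> class_map ` carrier (QG R emb S)" unfolding QG_carrier using q(1) by blast
  qed
qed

section \<open>The kernel\<close>

lemma group_UN1: "group (UN1 emb S)"
proof (rule groupI)
  show "\<one>\<^bsub>UN1 emb S\<^esub> \<in> carrier (UN1 emb S)" by (auto simp: UN1_def intro!: bexI[of _ 1])
  fix x assume x: "x \<in> carrier (UN1 emb S)"
  then obtain y where y: "x \<in> S" "y \<in> S" "x * y = 1" "N x = 1" by (auto simp: UN1_def)
  then have "N y = 1" using N_eq_inverse[of x y] by simp
  moreover have "y * x = 1" using y by (simp add: mult.commute)
  ultimately show "\<exists>y\<in>carrier (UN1 emb S). y \<otimes>\<^bsub>UN1 emb S\<^esub> x = \<one>\<^bsub>UN1 emb S\<^esub>"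
    using y by (intro bexI[of _ y]) (auto simp: UN1_def)
  show "\<one>\<^bsub>UN1 emb S\<^esub> \<otimes>\<^bsub>UN1 emb S\<^esub> x = x" by (simp add: UN1_def)
  fix z assume "z \<in> carrier (UN1 emb S)"
  then obtain w where z: "z \<in> S" "w \<in> S" "z * w = 1" "N z = 1" by (auto simp: UN1_def)
  have "(x * z) * (y * w) = (x * y) * (z * w)" by (simp add: algebra_simps)
  then have "(x * z) * (y * w) = 1" by (simp add: y z)
  then show "x \<otimes>\<^bsub>UN1 emb S\<^esub> z \<in> carrier (UN1 emb S)"
    using y z S_mult by (auto simp: UN1_def N_mult intro!: bexI[of _ "y * w"])
qed (simp add: UN1_def mult.assoc)

text \<open>The homomorphism to which the first isomorphism theorem is applied: its image is the
  kernel of \<open>class_map\<close>, and its own kernel consists of the cubes.\<close>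

definition unit_class :: "'l \<Rightarrow> ('l set \<times> 'l \<times> 'k) set" where
  "unit_class \<epsilon> = qcl R emb S (S, \<epsilon>, 1)"

abbreviation "ker_class \<equiv> kernel (QG R emb S) (ClSR3 R emb S) class_map"
abbreviation "ker_group \<equiv> QG R emb S\<lparr>carrier := ker_class\<rparr>"

lemma ker_class_iff:
  assumes "q \<in> QB R emb S"
  shows "qcl R emb S q \<in> ker_class \<longleftrightarrow> (\<exists>\<kappa>. Lunit \<kappa> \<and> fst q = scale \<kappa> S)"
proof -
  have "inv_ideal (fst q)" using QB_is_torsion[OF assms] by (simp add: is_torsion_def)
  then show ?thesis
    using assms by (simp add: kernel_def ClSR3_one class_map_qcl clS_eq_S_iff QG_carrier)
qed

lemma group_ker: "group ker_group"
proof -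
  interpret group_hom "QG R emb S" "ClSR3 R emb S" class_map
    using group_QG group_ClSR3 class_map_hom by (simp add: group_hom_def group_hom_axioms_def)
  show ?thesis by (rule G.subgroup_imp_group[OF subgroup_kernel])
qed

lemma unit_class_hom: "unit_class \<in> hom (UN1 emb S) ker_group"
proof (rule homI)
  fix x assume x: "x \<in> carrier (UN1 emb S)"
  have xQ: "(S, x, 1) \<in> QB R emb S" using x by (simp add: UN1_iff_QB)
  show "unit_class x \<in> carrier ker_group"
    using ker_class_iff[OF xQ] Lunit_1 by (auto simp: unit_class_def intro!: exI[of _ 1])
  fix y assume "y \<in> carrier (UN1 emb S)"
  then have yQ: "(S, y, 1) \<in> QB R emb S" by (simp add: UN1_iff_QB)
  have "qmult R emb (S, x, 1) (S, y, 1) = (S, x * y, 1)"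
    by (simp add: qmult_def prod_ideal_S frac_ideal_S_self)
  then show "unit_class (x \<otimes>\<^bsub>UN1 emb S\<^esub> y) = unit_class x \<otimes>\<^bsub>ker_group\<^esub> unit_class y"
    using QG_mult[OF xQ yQ] by (simp add: unit_class_def UN1_def)
qed

text \<open>A kernel class is normalised in two rescalings: the first makes the ideal equal to
  \<open>S\<close>, the second makes the last entry 1 while preserving \<open>S\<close>.\<close>

lemma unit_class_surj: "unit_class ` carrier (UN1 emb S) = carrier ker_group"
proof
  show "unit_class ` carrier (UN1 emb S) \<subseteq> carrier ker_group"
    using unit_class_hom unfolding hom_def by blast
  show "carrier ker_group \<subseteq> unit_class ` carrier (UN1 emb S)"
  proof
    fix A assume "A \<in> carrier ker_group"
    then have A: "A \<in> ker_class" by simp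
    then obtain q where q: "A = qcl R emb S q" "q \<in> QB R emb S" unfolding kernel_def QG_carrier by blast
    obtain \<kappa> where \<kappa>: "Lunit \<kappa>" "fst q = scale \<kappa> S" using A ker_class_iff[OF q(2)] q(1) by blast
    obtain \<mu> where \<mu>: "Lunit \<mu>" "\<mu> * \<kappa> = 1" using \<kappa>(1) obtain_inverse by blast
    have "fst (act \<mu> q) = S" using \<kappa>(2) by (cases q) (simp add: act_def scale_scale \<mu>)
    then obtain \<delta> s where \<delta>s: "act \<mu> q = (S, \<delta>, s)" by (metis prod.collapse)
    have Q: "(S, \<delta>, s) \<in> QB R emb S" using act_QB[OF q(2) \<mu>(1)] \<delta>s by simp
    note QB = Q[unfolded QB_iff]
    have "Lunit \<delta>" using QB by blast
    then obtain \<eta> where \<eta>: "Lunit \<eta>" "\<delta> * \<eta> = 1" "\<eta> * \<delta> = 1" "N \<delta> * N \<eta> = 1"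
      by (rule obtain_inverse)
    \<comment> \<open>The cube of \<open>S\<close> is \<open>S\<close>, so \<open>QB_cube\<close>
      makes \<open>\<delta>\<close>, and with it \<open>\<eta>\<close>, a unit of
      \<open>S\<close>.\<close>
    have "scale \<delta> S = S" using QB_cube[OF Q] by (simp add: cube_S)
    then have "scale (\<eta> * \<delta>) S = scale \<eta> S" by (simp flip: scale_scale)
    then have \<eta>S: "scale \<eta> S = S" by (simp add: \<eta>(3))
    \<comment> \<open>Both sides are the norm ideal of \<open>S\<close>, so \<open>s\<close> is a
      unit of \<open>R\<close>.\<close>
    have sR: "(\<lambda>r. s * r) ` R = R" using QB by (simp add: norm_ideal_S)
    have "s * 1 \<in> (\<lambda>r. s * r) ` R" by (rule imageI) simp
    then have s: "s \<in> R" by (simp only: sR mult_1_right)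
    have "1 \<in> (\<lambda>r. s * r) ` R" unfolding sR by simp
    then obtain t where t: "t \<in> R" "1 = s * t" by blast
    have "scale (emb s) S = S"
      unfolding scale_eq_S_iff using emb_S s t by (metis emb_1 emb_mult)
    then have "scale (emb s * \<eta>) S = S" by (simp only: scale_scale[symmetric] \<eta>S)
    \<comment> \<open>As \<open>N \<delta> = s\<^sup>3\<close>, the unit \<open>s / \<delta>\<close> has norm \<open>1 / s\<close> and normalises the last entry.\<close>
    moreover have N: "N (emb s * \<eta>) * s = 1"
    proof -
      have "N (emb s * \<eta>) * s = s ^ 3 * N \<eta>" by (simp add: N_mult N_emb power3_eq_cube)
      then show ?thesis using QB \<eta>(4) by simp
    qed
    ultimately have "act (emb s * \<eta>) (S, \<delta>, s) = (S, (emb s * \<eta>) ^ 3 * \<delta>, 1)" by (simp add: act_def)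
    then have eq: "act (emb s * \<eta> * \<mu>) q = (S, (emb s * \<eta>) ^ 3 * \<delta>, 1)" by (simp flip: act_act add: \<delta>s)
    have "N (emb s * \<eta>) \<noteq> 0" using N by auto
    then have unit: "Lunit (emb s * \<eta> * \<mu>)" using \<mu>(1) by (simp add: Lunit_iff N_mult)
    have Q': "(S, (emb s * \<eta>) ^ 3 * \<delta>, 1) \<in> QB R emb S" using act_QB[OF q(2) unit] eq by simp
    have "A = unit_class ((emb s * \<eta>) ^ 3 * \<delta>)"
      unfolding q(1) unit_class_def using qcl_eq_iff[OF q(2) Q'] unit eq by metis
    then show "A \<in> unit_class ` carrier (UN1 emb S)" using Q' UN1_iff_QB by blast
  qed
qed

text \<open>An element \<open>\<kappa>\<close> carrying \<open>(S, 1, 1)\<close> to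
  \<open>(S, x, 1)\<close> must stabilise \<open>S\<close>, have norm 1 and satisfy
  \<open>\<kappa> ^ 3 = x\<close>, so \<open>x\<close> is the cube of a norm-one unit; conversely
  such a unit gives the equivalence.\<close>

lemma unit_class_kernel: "kernel (UN1 emb S) ker_group unit_class = UN1_cubes emb S"
proof -
  have "x \<in> carrier (UN1 emb S) \<and> unit_class x = unit_class 1 \<longleftrightarrow> x \<in> UN1_cubes emb S" for x
  proof
    assume x: "x \<in> carrier (UN1 emb S) \<and> unit_class x = unit_class 1"
    then have "(S, x, 1) \<in> QB R emb S" by (simp add: UN1_iff_QB)
    then obtain \<kappa> where "(S, x, 1) = act \<kappa> (S, 1, 1)"
      using x qcl_eq_iff[OF one_QB, of "(S, x, 1)"] unfolding unit_class_def by metis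
    then have \<kappa>: "scale \<kappa> S = S" "x = \<kappa> ^ 3" "N \<kappa> = 1" by (auto simp: act_def)
    then have "\<kappa> \<in> carrier (UN1 emb S)" using scale_eq_S_iff by (simp add: UN1_def)
    then show "x \<in> UN1_cubes emb S" unfolding UN1_cubes_def \<kappa>(2) by blast
  next
    assume "x \<in> UN1_cubes emb S"
    then obtain \<kappa> where \<kappa>: "\<kappa> \<in> carrier (UN1 emb S)" "x = \<kappa> ^ 3" unfolding UN1_cubes_def by blast
    have N: "N \<kappa> = 1" and S: "scale \<kappa> S = S" using \<kappa>(1) scale_eq_S_iff by (auto simp: UN1_def)
    have act: "(S, x, 1) = act \<kappa> (S, 1, 1)" by (simp add: act_def N S \<kappa>(2))
    have unit: "Lunit \<kappa>" by (simp add: Lunit_iff N)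
    have "(S, x, 1) \<in> QB R emb S" unfolding act by (rule act_QB[OF one_QB unit])
    then show "x \<in> carrier (UN1 emb S) \<and> unit_class x = unit_class 1"
      using qcl_eq_iff[OF one_QB, of "(S, x, 1)"] act unit unfolding unit_class_def UN1_iff_QB by metis
  qed
  then show ?thesis unfolding kernel_def by (auto simp: QG_one unit_class_def)
qed

lemma ker_group_iso: "ker_group \<cong> (UN1 emb S Mod UN1_cubes emb S)"
proof -
  interpret group_hom "UN1 emb S" ker_group unit_class
    using group_UN1 group_ker unit_class_hom by (simp add: group_hom_def group_hom_axioms_def)
  have "UN1 emb S Mod UN1_cubes emb S \<cong> ker_group"
    using FactGroup_iso[OF unit_class_surj] unfolding unit_class_kernel .
  \<comment> \<open>The first isomorphism theorem points from the quotient to the kernel group;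
    reversing it requires the quotient to be a group.\<close>
  moreover have "group (UN1 emb S Mod UN1_cubes emb S)"
    using normal.factorgroup_is_group[OF normal_kernel] unfolding unit_class_kernel .
  ultimately show ?thesis by (rule group.iso_sym[rotated])
qed

end

theorem mainTheorem4:
  fixes R :: "'k::field set" and emb :: "'k \<Rightarrow> 'l::comm_ring_1"
    and S :: "'l set" and a :: "'k set" and c :: 'k
  assumes "dedekind_domain R"
    and "(3::'k) \<noteq> 0"
    and "frac_ideal_R R a"
    and "dim2_alg emb"
    and "quad_alg R emb S"
    and "nondeg emb"
    and "steinitz_is R emb S a"
    and "orientation R emb S a c"
  shows "group (QG R emb S) \<and> group (ClSR3 R emb S) \<and>
    (\<exists>h. h \<in> hom (QG R emb S) (ClSR3 R emb S) \<and>
         (\<forall>q \<in> QB R emb S. h (qcl R emb S q) = clS R emb S (fst q)) \<and>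
         h ` carrier (QG R emb S) = carrier (ClSR3 R emb S) \<and>
         (QG R emb S)\<lparr>carrier := kernel (QG R emb S) (ClSR3 R emb S) h\<rparr>
           \<cong> (UN1 emb S Mod UN1_cubes emb S))"
proof -
  interpret quadratic_order emb R S
    using assms by unfold_locales
  show ?thesis
    using group_QG group_ClSR3 class_map_hom class_map_qcl class_map_surj ker_group_iso by blast
qed

end
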